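(* Let $\bar Q$ be the true parameter of the tracking problem described in the context, let $\bar q_t=-\bar Q x_t^r$ for $t=1,\dots,\nu_2$, and let $\bar P_{1:\nu_2}$, $\bar\eta_{1:\nu_2}$ be generated from $(\bar Q,\bar q_{1:\nu_2})$ by the Riccati iterations given in the context. Suppose that: (1) $\nu_2\in\mathbb{Z}_+$ is known, $\nu_2\ge n+1$, $\mathbb{P}(\mathscr{N}\in[\nu_1,\nu_2])=1$ with $\nu_1\in\mathbb{Z}_+$, $\nu_1\le\nu_2$, and $\mathbb{P}(\mathscr{N}=\nu_2)>0$; (2) $(A,B)$ is controllable, $B$ has full column rank, and $A$ is invertible; (3) the random elements $(\bar{\boldsymbol{x}},\mathscr{N})$ and $\{\boldsymbol{w}_t\}_{t=1}^\infty$ are all independent (that is, $(\bar{\boldsymbol{x}},\mathscr{N}),\boldsymbol{w}_1,\boldsymbol{w}_2,\dots$ are mutually independent), the $\boldsymbol{w}_t$ are identically distributed with $\mathbb{E}[\boldsymbol{w}_t]=0$ and $\operatorname{cov}(\boldsymbol{w}_t,\boldsymbol{w}_t)=\Sigma_w\succ0$, where $\Sigma_w$ is known and $\|\Sigma_w\|_F<\infty$; (4) the conditional covariance of $\bar{\boldsymbol{x}}$ given $\mathscr{N}=\nu_2$ is strictly positive definite, and $\mathbb{E}[\|\bar{\boldsymbol{x}}\|^2]<\infty$; (5) $\bar Q\in\mathbb{G}(\varphi)=\{Q\in\mathbb{S}^n_+ : \|Q\|_F\le\varphi\}$ for some $0<\varphi<\infty$. Then $(\bar Q,\bar q_{1:\nu_2},\bar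 P_{1:\nu_2},\bar\eta_{1:\nu_2})$ is the unique optimal solution of the convex optimization problem (IOC) defined in the context; that is, there is $\xi_{1:\nu_2-1}$ such that $(\bar Q,\bar q_{1:\nu_2},\bar P_{1:\nu_2},\bar\eta_{1:\nu_2},\xi_{1:\nu_2-1})$ is optimal for (IOC), and every optimal solution of (IOC) has $(Q,q_{1:\nu_2},P_{1:\nu_2},\eta_{1:\nu_2})$-components equal to $(\bar Q,\bar q_{1:\nu_2},\bar P_{1:\nu_2},\bar\eta_{1:\nu_2})$.
   Context: Notation: $\mathbb{S}^n_+$ is the set of real symmetric positive semidefinite $n\times n$ matrices, $\succeq,\succ$ refer to the Loewner order, $\|\cdot\|$ is the Euclidean norm, $\|\cdot\|_F$ the Frobenius norm, $\mathbb{Z}_+$ the positive integers, and $v_{a:b}$ denotes the tuple $(v_a,\dots,v_b)$. Forward problem. $A\in\mathbb{R}^{n\times n}$, $B\in\mathbb{R}^{n\times m}$ are given, and $x_1^r,\dots,x_{\nu_2}^r\in\mathbb{R}^n$ is a known reference signal. On a probability space there are a random initial state $\bar{\boldsymbol{x}}\in\mathbb{R}^n$, a random planning horizon $\mathscr{N}\in\{\nu_1,\dots,\nu_2\}$, and process noise vectors $\boldsymbol{w}_t\in\mathbb{R}^m$. Given a realization $(\bar x,N)$ of $(\bar{\boldsymbol{x}},\mathscr{N})$, the agent's states $\boldsymbol{x}_t\in\mathbb{R}^n$ and controls $\boldsymbol{u}_t\in\mathbb{R}^m$ are the optimal ones (controls being causal, i.e. $\boldsymbol{u}_t$ may depend on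 information up to time $t$ but not on $\boldsymbol{w}_t,\boldsymbol{w}_{t+1},\dots$) for minimizing $$\mathbb{E}\Big[\tfrac12(\boldsymbol{x}_{\nu_2}-x^r_{\nu_2})^T\bar Q(\boldsymbol{x}_{\nu_2}-x^r_{\nu_2})+\sum_{t=\nu_2-N+1}^{\nu_2-1}\Big(\tfrac12(\boldsymbol{x}_t-x_t^r)^T\bar Q(\boldsymbol{x}_t-x_t^r)+\tfrac12\|\boldsymbol{u}_t\|^2\Big)\Big]$$ (expectation over the noise) subject to $\boldsymbol{x}_{t+1}=A\boldsymbol{x}_t+B(\boldsymbol{u}_t+\boldsymbol{w}_t)$ for $t=\nu_2-N+1,\dots,\nu_2-1$, $\boldsymbol{x}_{\nu_2-N+1}=\bar x$, and $\boldsymbol{x}_t=0$, $\boldsymbol{u}_t=0$ for $t=1,\dots,\nu_2-N$. Here $\bar Q\in\mathbb{S}^n_+$ is the true (unknown) parameter. With $\bar q_t=-\bar Qx_t^r$, the Riccati iterations are: $\bar P_{\nu_2}=\bar Q$, $\bar\eta_{\nu_2}=\bar q_{\nu_2}$, and for $t=\nu_2-1,\dots,1$, $$\bar P_t=A^T\bar P_{t+1}A+\bar Q-A^T\bar P_{t+1}B(B^T\bar P_{t+1}B+I)^{-1}B^T\bar P_{t+1}A,$$ $$\bar\eta_t=\big(A-B(B^T\bar P_{t+1}B+I)^{-1}B^T\bar P_{t+1}A\big)^T\bar\eta_{t+1}+\bar q_t.$$ The optimal control is $\boldsymbol{u}_t=-(B^T\bar P_{t+1}B+I)^{-1}(B^T\bar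 P_{t+1}A\boldsymbol{x}_t+B^T\bar\eta_{t+1})$ for $t=\nu_2-N+1,\dots,\nu_2-1$. This determines the joint law of $(\boldsymbol{x}_{1:\nu_2},\mathscr{N})$. Problem (IOC). Minimize $\Psi(Q,q_{1:\nu_2},P_{1:\nu_2},\eta_{1:\nu_2},\xi_{1:\nu_2-1})$ over $Q\in\mathbb{G}(\varphi)$, $q_t\in\mathbb{R}^n$, $P_t\in\mathbb{S}^n_+$, $\eta_t\in\mathbb{R}^n$ ($t=1,\dots,\nu_2$), $\xi_t\in\mathbb{R}$ ($t=1,\dots,\nu_2-1$), subject to $P_{\nu_2}=Q$, $\eta_{\nu_2}=q_{\nu_2}$, $q_t=-Qx_t^r$ for $t=1,\dots,\nu_2$, and $$\begin{bmatrix}B^TP_{t+1}B+I & B^TP_{t+1}A & B^T\eta_{t+1}\\ A^TP_{t+1}B & A^TP_{t+1}A+Q-P_t & \beta_t\\ \eta_{t+1}^TB & \beta_t^T & \xi_t\end{bmatrix}\succeq0,\qquad t=1,\dots,\nu_2-1,$$ where $\beta_t=q_t+A^T\eta_{t+1}-\eta_t$. The objective is $$\Psi=\mathbb{E}_{\boldsymbol{x}_{1:\nu_2},\mathscr{N}}\Big[\tfrac12\boldsymbol{x}_{\nu_2}^TP_{\nu_2}\boldsymbol{x}_{\nu_2}+\eta_{\nu_2}^T\boldsymbol{x}_{\nu_2}-\tfrac12\boldsymbol{x}_{\nu_2-\mathscr{N}+1}^TP_{\nu_2-\mathscr{N}+1}\boldsymbol{x}_{\nu_2-\mathscr{N}+1}-\eta_{\nu_2-\mathscr{N}+1}^T\boldsymbol{x}_{\nu_2-\mathscr{N}+1}+\sum_{t=\nu_2-\mathscr{N}+1}^{\nu_2-1}\Big(\tfrac12\xi_t+\tfrac12\boldsymbol{x}_t^TQ\boldsymbol{x}_t+q_t^T\boldsymbol{x}_t-\tfrac12\operatorname{tr}(B^TP_{t+1}B\Sigma_w)\Big)\Big],$$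 where the expectation is over the joint law of $(\boldsymbol{x}_{1:\nu_2},\mathscr{N})$ generated by the forward problem with the true $\bar Q$. *)

theory Defs
  imports "HOL-Probability.Probability"
begin

definition symmetric_matrix :: "real^'k^'k \<Rightarrow> bool" where
  "symmetric_matrix S \<longleftrightarrow> transpose S = S"

definition psd :: "real^'k^'k \<Rightarrow> bool" where
  "psd S \<longleftrightarrow> symmetric_matrix S \<and> (\<forall>v. 0 \<le> v \<bullet> (S *v v))"

definition pos_def :: "real^'k^'k \<Rightarrow> bool" where
  "pos_def S \<longleftrightarrow> symmetric_matrix S \<and> (\<forall>v. v \<noteq> 0 \<longrightarrow> 0 < v \<bullet> (S *v v))"

(* The norm of the type real^'n^'n is the Frobenius norm. *)
definition bounded_psd :: "real \<Rightarrow> (real^'n^'n) set" where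
  "bounded_psd \<phi> = {Q. psd Q \<and> norm Q \<le> \<phi>}"

(* The union is the set of columns of the controllability matrix [B, A B, ..., A^(n-1) B], so its
   dimension is the rank of that matrix. *)
definition controllable :: "real^'n^'n \<Rightarrow> real^'m^'n \<Rightarrow> bool" where
  "controllable A B \<longleftrightarrow>
     dim (\<Union>k<CARD('n). columns (((\<lambda>X. A ** X) ^^ k) B)) = CARD('n)"

definition block_matrix3 ::
  "real^'m^'m \<Rightarrow> real^'n^'m \<Rightarrow> real^'m \<Rightarrow>
   real^'m^'n \<Rightarrow> real^'n^'n \<Rightarrow> real^'n \<Rightarrow>
   real^'m \<Rightarrow> real^'n \<Rightarrow> real \<Rightarrow> real^('m + 'n + unit)^('m + 'n + unit)" where
  "block_matrix3 M11 M12 M13 M21 M22 M23 M31 M32 M33 =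
     (\<chi> i j. case i of
        Inl a \<Rightarrow> (case j of Inl b \<Rightarrow> M11 $ a $ b | Inr (Inl d) \<Rightarrow> M12 $ a $ d | Inr (Inr _) \<Rightarrow> M13 $ a)
      | Inr (Inl c) \<Rightarrow>
          (case j of Inl b \<Rightarrow> M21 $ c $ b | Inr (Inl d) \<Rightarrow> M22 $ c $ d | Inr (Inr _) \<Rightarrow> M23 $ c)
      | Inr (Inr _) \<Rightarrow>
          (case j of Inl b \<Rightarrow> M31 $ b | Inr (Inl d) \<Rightarrow> M32 $ d | Inr (Inr _) \<Rightarrow> M33))"

definition covariance_matrix ::
  "'a measure \<Rightarrow> ('a \<Rightarrow> real^'k) \<Rightarrow> ('a \<Rightarrow> real^'l) \<Rightarrow> real^'l^'k" where
  "covariance_matrix M X Y =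
     (\<chi> i j. \<integral>\<omega>. (X \<omega> - (\<integral>\<omega>'. X \<omega>' \<partial>M)) $ i * (Y \<omega> - (\<integral>\<omega>'. Y \<omega>' \<partial>M)) $ j \<partial>M)"

definition initial_sigma :: "'a measure \<Rightarrow> ('a \<Rightarrow> real^'n) \<Rightarrow> ('a \<Rightarrow> nat) \<Rightarrow> 'a measure" where
  "initial_sigma M xbar N =
     vimage_algebra (space M) (\<lambda>\<omega>. (xbar \<omega>, N \<omega>)) (borel \<Otimes>\<^sub>M count_space UNIV)"

definition noise_sigma :: "'a measure \<Rightarrow> (nat \<Rightarrow> 'a \<Rightarrow> real^'m) \<Rightarrow> nat \<Rightarrow> 'a measure" where
  "noise_sigma M w t = vimage_algebra (space M) (w t) borel"

(* Mutual independence of (xbar, N), w 1, w 2, ...; index 0 stands for the pair (xbar, N).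
   The constant indep_vars needs all variables to have the same codomain, hence the
   generated sigma-algebras. *)
definition independent_inputs ::
  "'a measure \<Rightarrow> ('a \<Rightarrow> real^'n) \<Rightarrow> ('a \<Rightarrow> nat) \<Rightarrow> (nat \<Rightarrow> 'a \<Rightarrow> real^'m) \<Rightarrow> bool" where
  "independent_inputs M xbar N w \<longleftrightarrow>
     prob_space.indep_sets M
       (\<lambda>i. if i = 0 then sets (initial_sigma M xbar N) else sets (noise_sigma M w i)) UNIV"

(* The information available to the agent at time t: xbar, N and w 1, ..., w (t - 1). *)
definition information ::
  "'a measure \<Rightarrow> ('a \<Rightarrow> real^'n) \<Rightarrow> ('a \<Rightarrow> nat) \<Rightarrow> (nat \<Rightarrow> 'a \<Rightarrow> real^'m) \<Rightarrow> nat \<Rightarrow> 'a measure" where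
  "information M xbar N w t =
     sigma (space M) (sets (initial_sigma M xbar N) \<union> (\<Union>s\<in>{1..<t}. sets (noise_sigma M w s)))"

definition forward_feasible ::
  "real^'n^'n \<Rightarrow> real^'m^'n \<Rightarrow> nat \<Rightarrow> 'a measure \<Rightarrow> ('a \<Rightarrow> real^'n) \<Rightarrow> ('a \<Rightarrow> nat) \<Rightarrow>
   (nat \<Rightarrow> 'a \<Rightarrow> real^'m) \<Rightarrow> (nat \<Rightarrow> 'a \<Rightarrow> real^'n) \<Rightarrow> (nat \<Rightarrow> 'a \<Rightarrow> real^'m) \<Rightarrow> bool" where
  "forward_feasible A B \<nu>2 M xbar N w x u \<longleftrightarrow>
     (\<forall>t\<in>{1..<\<nu>2}. u t \<in> borel_measurable (information M xbar N w t)) \<and>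
     (\<forall>\<omega>\<in>space M.
        (\<forall>t\<in>{\<nu>2 - N \<omega> + 1..<\<nu>2}. x (t + 1) \<omega> = A *v x t \<omega> + B *v (u t \<omega> + w t \<omega>)) \<and>
        x (\<nu>2 - N \<omega> + 1) \<omega> = xbar \<omega> \<and>
        (\<forall>t\<in>{1..\<nu>2 - N \<omega>}. x t \<omega> = 0 \<and> u t \<omega> = 0))"

definition forward_cost ::
  "nat \<Rightarrow> (nat \<Rightarrow> real^'n) \<Rightarrow> real^'n^'n \<Rightarrow> ('a \<Rightarrow> nat) \<Rightarrow>
   (nat \<Rightarrow> 'a \<Rightarrow> real^'n) \<Rightarrow> (nat \<Rightarrow> 'a \<Rightarrow> real^'m) \<Rightarrow> 'a \<Rightarrow> real" where
  "forward_cost \<nu>2 xr Q N x u \<omega> =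
     1/2 * ((x \<nu>2 \<omega> - xr \<nu>2) \<bullet> (Q *v (x \<nu>2 \<omega> - xr \<nu>2))) +
     (\<Sum>t\<in>{\<nu>2 - N \<omega> + 1..<\<nu>2}.
        1/2 * ((x t \<omega> - xr t) \<bullet> (Q *v (x t \<omega> - xr t))) + 1/2 * (norm (u t \<omega>))\<^sup>2)"

(* Conditional expectation given (xbar, N), i.e. expectation over the noise for a given realization.
   For psd Q the cost is nonnegative, so ennreal does not truncate it, and an infinite expected
   cost is allowed. *)
definition forward_expected_cost ::
  "nat \<Rightarrow> (nat \<Rightarrow> real^'n) \<Rightarrow> real^'n^'n \<Rightarrow> 'a measure \<Rightarrow> ('a \<Rightarrow> real^'n) \<Rightarrow> ('a \<Rightarrow> nat) \<Rightarrow>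
   (nat \<Rightarrow> 'a \<Rightarrow> real^'n) \<Rightarrow> (nat \<Rightarrow> 'a \<Rightarrow> real^'m) \<Rightarrow> 'a \<Rightarrow> ennreal" where
  "forward_expected_cost \<nu>2 xr Q M xbar N x u =
     nn_cond_exp M (initial_sigma M xbar N) (\<lambda>\<omega>. ennreal (forward_cost \<nu>2 xr Q N x u \<omega>))"

definition forward_optimal ::
  "real^'n^'n \<Rightarrow> real^'m^'n \<Rightarrow> nat \<Rightarrow> (nat \<Rightarrow> real^'n) \<Rightarrow> real^'n^'n \<Rightarrow>
   'a measure \<Rightarrow> ('a \<Rightarrow> real^'n) \<Rightarrow> ('a \<Rightarrow> nat) \<Rightarrow> (nat \<Rightarrow> 'a \<Rightarrow> real^'m) \<Rightarrow>
   (nat \<Rightarrow> 'a \<Rightarrow> real^'n) \<Rightarrow> (nat \<Rightarrow> 'a \<Rightarrow> real^'m) \<Rightarrow> bool" where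
  "forward_optimal A B \<nu>2 xr Q M xbar N w x u \<longleftrightarrow>
     forward_feasible A B \<nu>2 M xbar N w x u \<and>
     (\<forall>x' u'. forward_feasible A B \<nu>2 M xbar N w x' u' \<longrightarrow>
        (AE \<omega> in M. forward_expected_cost \<nu>2 xr Q M xbar N x u \<omega>
                    \<le> forward_expected_cost \<nu>2 xr Q M xbar N x' u' \<omega>))"

definition feedback_gain :: "real^'n^'n \<Rightarrow> real^'m^'n \<Rightarrow> real^'n^'n \<Rightarrow> real^'n^'m" where
  "feedback_gain A B P =
     matrix_inv (transpose B ** P ** B + mat 1) ** transpose B ** P ** A"

definition riccati_iterations ::
  "real^'n^'n \<Rightarrow> real^'m^'n \<Rightarrow> nat \<Rightarrow> real^'n^'n \<Rightarrow> (nat \<Rightarrow> real^'n) \<Rightarrow>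
   (nat \<Rightarrow> real^'n^'n) \<Rightarrow> (nat \<Rightarrow> real^'n) \<Rightarrow> bool" where
  "riccati_iterations A B \<nu>2 Q q P \<eta> \<longleftrightarrow>
     P \<nu>2 = Q \<and> \<eta> \<nu>2 = q \<nu>2 \<and>
     (\<forall>t\<in>{1..<\<nu>2}.
        P t = transpose A ** P (t + 1) ** A + Q
              - transpose A ** P (t + 1) ** B ** feedback_gain A B (P (t + 1)) \<and>
        \<eta> t = transpose (A - B ** feedback_gain A B (P (t + 1))) *v \<eta> (t + 1) + q t)"

(* Decision variables (Q, q, P, eta, xi); only the values of q, P, eta at 1, ..., nu2 and of xi at
   1, ..., nu2 - 1 are relevant. *)
type_synonym 'n ioc_vars =
  "(real^'n^'n) \<times> (nat \<Rightarrow> real^'n) \<times> (nat \<Rightarrow> real^'n^'n) \<times> (nat \<Rightarrow> real^'n) \<times> (nat \<Rightarrow> real)"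

definition lmi_matrix ::
  "real^'n^'n \<Rightarrow> real^'m^'n \<Rightarrow> 'n::finite ioc_vars \<Rightarrow> nat \<Rightarrow>
   real^('m + 'n + unit)^('m + 'n + unit)" where
  "lmi_matrix A B = (\<lambda>(Q, q, P, \<eta>, \<xi>) t.
     let \<beta> = q t + transpose A *v \<eta> (t + 1) - \<eta> t in
     block_matrix3
       (transpose B ** P (t + 1) ** B + mat 1) (transpose B ** P (t + 1) ** A) (transpose B *v \<eta> (t + 1))
       (transpose A ** P (t + 1) ** B) (transpose A ** P (t + 1) ** A + Q - P t) \<beta>
       (\<eta> (t + 1) v* B) \<beta> (\<xi> t))"

definition ioc_feasible ::
  "real^'n^'n \<Rightarrow> real^'m^'n \<Rightarrow> nat \<Rightarrow> (nat \<Rightarrow> real^'n) \<Rightarrow> real \<Rightarrow> 'n::finite ioc_vars \<Rightarrow> bool" where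
  "ioc_feasible A B \<nu>2 xr \<phi> = (\<lambda>(Q, q, P, \<eta>, \<xi>).
     Q \<in> bounded_psd \<phi> \<and>
     (\<forall>t\<in>{1..\<nu>2}. psd (P t)) \<and>
     P \<nu>2 = Q \<and> \<eta> \<nu>2 = q \<nu>2 \<and>
     (\<forall>t\<in>{1..\<nu>2}. q t = - (Q *v xr t)) \<and>
     (\<forall>t\<in>{1..<\<nu>2}. psd (lmi_matrix A B (Q, q, P, \<eta>, \<xi>) t)))"

definition ioc_objective ::
  "real^'m^'n \<Rightarrow> nat \<Rightarrow> real^'m^'m \<Rightarrow> 'a measure \<Rightarrow> ('a \<Rightarrow> nat) \<Rightarrow> (nat \<Rightarrow> 'a \<Rightarrow> real^'n) \<Rightarrow>
   'n::finite ioc_vars \<Rightarrow> real" where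
  "ioc_objective B \<nu>2 \<Sigma>w M N x = (\<lambda>(Q, q, P, \<eta>, \<xi>).
     \<integral>\<omega>. (let s = \<nu>2 - N \<omega> + 1 in
        1/2 * (x \<nu>2 \<omega> \<bullet> (P \<nu>2 *v x \<nu>2 \<omega>)) + \<eta> \<nu>2 \<bullet> x \<nu>2 \<omega>
        - 1/2 * (x s \<omega> \<bullet> (P s *v x s \<omega>)) - \<eta> s \<bullet> x s \<omega>
        + (\<Sum>t\<in>{s..<\<nu>2}.
             1/2 * \<xi> t + 1/2 * (x t \<omega> \<bullet> (Q *v x t \<omega>)) + q t \<bullet> x t \<omega>
             - 1/2 * trace (transpose B ** P (t + 1) ** B ** \<Sigma>w))) \<partial>M)"

definition ioc_optimal ::
  "real^'n^'n \<Rightarrow> real^'m^'n \<Rightarrow> nat \<Rightarrow> (nat \<Rightarrow> real^'n) \<Rightarrow> real \<Rightarrow> real^'m^'m \<Rightarrow>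
   'a measure \<Rightarrow> ('a \<Rightarrow> nat) \<Rightarrow> (nat \<Rightarrow> 'a \<Rightarrow> real^'n) \<Rightarrow> 'n::finite ioc_vars \<Rightarrow> bool" where
  "ioc_optimal A B \<nu>2 xr \<phi> \<Sigma>w M N x =
     is_arg_min (ioc_objective B \<nu>2 \<Sigma>w M N x) (ioc_feasible A B \<nu>2 xr \<phi>)"

end

theory Submission
  imports Defs
begin

text \<open>Evaluating the linear matrix inequality at time \<open>t\<close> on the vector
  \<open>z = (u\<^sub>t, x\<^sub>t, 1)\<close> gives twice the expected one-step change of the value function plus
  the stage cost. Summing over time, the objective plus the (parameter independent) expected control
  energy \<open>1/2 \<Sum> E \<parallel>u\<^sub>t\<parallel>\<^sup>2\<close> equals half the expected sum of the nonnegative quadratic forms of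
  the constraint matrices. The true parameter makes all of them vanish: there the form is the completed
  square \<open>(u + K x + k) \<bullet> R (u + K x + k)\<close>. The same identity applied to the forward cost shows that
  every optimal control is the affine feedback \<open>u = - K x - k\<close>.

  For another minimizer all forms vanish almost surely, so the constraint matrices annihilate
  \<open>(- K x\<^sub>t - k, x\<^sub>t, 1)\<close>. On the event of full horizon the state is not confined to
  any affine hyperplane, hence the coefficients vanish: the minimizer satisfies a Riccati recursion with
  the same gains. Equal gains force \<open>B\<^sup>T (P - Pbar) = 0\<close> at the times \<open>2, \<dots>, \<nu>2\<close>, which propagates
  along the recursion to \<open>(Q - Qbar) A\<^sup>i B = 0\<close> for \<open>i < n\<close>, and controllability yields
  \<open>Q = Qbar\<close>.\<close>

text \<open>The gains determine \<open>B\<^sup>T P\<close> because the gain equation is a fixed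
  point, \<open>K = B\<^sup>T P (A - B K)\<close>, and \<open>A - B K\<close> inherits invertibility
  from \<open>A\<close>. The nonlinear terms of the two recursions then cancel, and the difference
  obeys the linear recursion \<open>D t = A\<^sup>T D (t + 1) A + (Q - Qbar)\<close>. Since
  \<open>B\<close> meets only the matrices at times 2 and later, \<open>A\<^sup>i B\<close> is
  annihilated at times \<open>i + 2\<close> and later; reaching \<open>i = n - 1\<close> at the
  final time takes \<nu>2 \<ge> n + 1.

  Invertibility of the closed loop serves a second time: it carries an affine relation for the state
  back to the initial state, where the conditional covariance excludes it.

  The obstacle is integrability. Forward optimality is stated for controls without moment bounds,
  while the expectation identities need finite second moments. The affine feedback is therefore
  constructed as an explicit competitor of finite cost; the optimum then has finite cost too, and
  the cost dominates its control energy.\<close>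

section \<open>Symmetric and block matrices\<close>

lemma psd_symmetric: "psd S \<Longrightarrow> transpose S = S"
  by (simp add: psd_def symmetric_matrix_def)

lemma pos_def_symmetric: "pos_def S \<Longrightarrow> transpose S = S"
  by (simp add: pos_def_def symmetric_matrix_def)

lemma vector_matrix_mult_symmetric: "transpose S = S \<Longrightarrow> v v* S = S *v v" for S :: "real^'k^'k"
  by (metis transpose_matrix_vector)

lemma inner_symmetric_matrix:
  "transpose S = S \<Longrightarrow> u \<bullet> (S *v v) = v \<bullet> (S *v u)" for S :: "real^'k^'k"
  by (metis dot_lmul_matrix inner_commute vector_matrix_mult_symmetric)

lemma inner_vector_matrix: "x \<bullet> (y v* A) = (A *v x) \<bullet> y" for A :: "real^'k^'l"
  by (metis dot_lmul_matrix inner_commute)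

text \<open>At a zero the form is minimal, so its first variation vanishes in every direction; in
  the direction \<open>y = S *v v\<close> that variation is
  \<open>2 * (y \<bullet> y)\<close>.\<close>

lemma psd_quadratic_form_eq_0:
  fixes S :: "real^'k^'k"
  assumes S: "psd S" and v: "v \<bullet> (S *v v) = 0"
  shows "S *v v = 0"
proof -
  define y where "y = S *v v"
  have pos: "0 \<le> 2 * r * (y \<bullet> y) + r\<^sup>2 * (y \<bullet> (S *v y))" for r
  proof -
    have "0 \<le> (v + r *\<^sub>R y) \<bullet> (S *v (v + r *\<^sub>R y))"
      using S by (simp add: psd_def)
    also have "\<dots> = v \<bullet> (S *v v) + 2 * r * (y \<bullet> (S *v v)) + r\<^sup>2 * (y \<bullet> (S *v y))"
      using inner_symmetric_matrix[OF psd_symmetric[OF S], of v y]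
      by (simp add: matrix_vector_right_distrib matrix_vector_mult_scaleR inner_simps
          power2_eq_square algebra_simps)
    finally show ?thesis using v by (simp add: y_def)
  qed
  define c where "c = y \<bullet> (S *v y)"
  have c: "c \<ge> 0" using S by (simp add: psd_def c_def)
  have "y \<bullet> y \<le> 0"
  proof (rule ccontr)
    assume "\<not> y \<bullet> y \<le> 0"
    then have y: "y \<bullet> y > 0" by linarith
    \<comment> \<open>Negative, and small enough that the quadratic term takes back at most half of
      the linear gain; the \<open>+ 1\<close> keeps the denominator positive when
      \<open>c = 0\<close>.\<close>
    define r where "r = - (y \<bullet> y) / (c + 1)"
    have "r < 0" using y c by (simp add: r_def divide_neg_pos)
    have "2 * r * (y \<bullet> y) + r\<^sup>2 * c = r * (2 * (y \<bullet> y) + r * c)"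
      by (simp add: power2_eq_square algebra_simps)
    moreover have "r * c \<ge> - (y \<bullet> y)"
      using y c by (simp add: r_def field_simps)
    then have "2 * (y \<bullet> y) + r * c > 0" using y by linarith
    with \<open>r < 0\<close> have "r * (2 * (y \<bullet> y) + r * c) < 0" by (simp add: mult_neg_pos)
    ultimately show False using pos[of r] by (simp add: c_def)
  qed
  then show ?thesis by (metis inner_gt_zero_iff not_le y_def)
qed

section \<open>Vectors and matrices in blocks of sizes m, n and 1\<close>

definition block_vec3 :: "real^'m \<Rightarrow> real^'n \<Rightarrow> real \<Rightarrow> real^('m + 'n + unit)" where
  "block_vec3 u x c =
     (\<chi> i. case i of Inl a \<Rightarrow> u $ a | Inr (Inl b) \<Rightarrow> x $ b | Inr (Inr _) \<Rightarrow> c)"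

lemma block_vec3_cases:
  obtains u x c where "z = block_vec3 u x c"
proof
  show "z = block_vec3 (\<chi> a. z $ Inl a) (\<chi> b. z $ Inr (Inl b)) (z $ Inr (Inr ()))"
    by (auto simp: block_vec3_def vec_eq_iff split: sum.splits)
qed

lemma sum_block_index:
  fixes f :: "'m::finite + 'n::finite + unit \<Rightarrow> real"
  shows "sum f UNIV = (\<Sum>a\<in>UNIV. f (Inl a)) + (\<Sum>b\<in>UNIV. f (Inr (Inl b))) + f (Inr (Inr ()))"
  by (simp add: UNIV_Plus_UNIV[symmetric] sum.Plus UNIV_unit del: UNIV_Plus_UNIV)

lemma block_vec3_inject:
  "block_vec3 u x c = block_vec3 u' x' c' \<longleftrightarrow> u = u' \<and> x = x' \<and> c = c'"
proof
  assume eq: "block_vec3 u x c = block_vec3 u' x' c'"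
  have "u $ a = u' $ a" for a
    using arg_cong[OF eq, of "\<lambda>z. z $ Inl a"] by (simp add: block_vec3_def)
  moreover have "x $ b = x' $ b" for b
    using arg_cong[OF eq, of "\<lambda>z. z $ Inr (Inl b)"] by (simp add: block_vec3_def)
  moreover have "c = c'"
    using arg_cong[OF eq, of "\<lambda>z. z $ Inr (Inr ())"] by (simp add: block_vec3_def)
  ultimately show "u = u' \<and> x = x' \<and> c = c'" by (simp add: vec_eq_iff)
qed simp

lemma block_vec3_zero: "0 = block_vec3 0 0 0"
  by (auto simp: block_vec3_def vec_eq_iff split: sum.splits)

lemma inner_block_vec3: "block_vec3 u x c \<bullet> block_vec3 u' x' c' = u \<bullet> u' + x \<bullet> x' + c * c'"
  by (simp add: inner_vec_def sum_block_index block_vec3_def)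

lemma block_matrix3_mult_block_vec3:
  "block_matrix3 M11 M12 M13 M21 M22 M23 M31 M32 M33 *v block_vec3 u x c =
   block_vec3 (M11 *v u + M12 *v x + c *\<^sub>R M13) (M21 *v u + M22 *v x + c *\<^sub>R M23)
     (M31 \<bullet> u + M32 \<bullet> x + M33 * c)"
  by (auto simp: vec_eq_iff matrix_vector_mult_def sum_block_index block_matrix3_def
      block_vec3_def inner_vec_def algebra_simps split: sum.splits)

lemma transpose_block_matrix3:
  "transpose (block_matrix3 M11 M12 M13 M21 M22 M23 M31 M32 M33) =
   block_matrix3 (transpose M11) (transpose M21) M31 (transpose M12) (transpose M22) M32 M13 M23 M33"
  by (auto simp: vec_eq_iff transpose_def block_matrix3_def split: sum.splits)

section \<open>The Riccati recursion and the linear matrix inequality\<close>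

text \<open>For a Riccati solution this is the cost-to-go of the tracking problem, up to a term that
  does not depend on the state.\<close>

definition quadratic_value :: "real^'n^'n \<Rightarrow> real^'n \<Rightarrow> real^'n \<Rightarrow> real" where
  "quadratic_value P \<eta> x = 1/2 * (x \<bullet> (P *v x)) + \<eta> \<bullet> x"

text \<open>The step \<open>A *v x + B *v u\<close> is noise-free; the noise enters later and
  contributes only a trace in expectation. The entry 1 of the block vector lets a quadratic form
  carry the linear and constant terms.\<close>

lemma lmi_quadratic_form:
  fixes A :: "real^'n^'n" and B :: "real^'m^'n"
  assumes P: "transpose (P (t + 1)) = P (t + 1)"
  shows "block_vec3 u x 1 \<bullet> (lmi_matrix A B (Q, q, P, \<eta>, \<xi>) t *v block_vec3 u x 1) =
    2 * (quadratic_value (P (t + 1)) (\<eta> (t + 1)) (A *v x + B *v u) - quadratic_value (P t) (\<eta> t) x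
      + 1/2 * (norm u)\<^sup>2 + 1/2 * (x \<bullet> (Q *v x)) + q t \<bullet> x + 1/2 * \<xi> t)"
proof -
  have 1: "(A *v x) \<bullet> (P (t + 1) *v (B *v u)) = (B *v u) \<bullet> (P (t + 1) *v (A *v x))"
    by (rule inner_symmetric_matrix[OF P])
  show ?thesis
    using 1
    by (simp add: lmi_matrix_def Let_def block_matrix3_mult_block_vec3 inner_block_vec3
        quadratic_value_def algebra_simps inner_simps dot_lmul_matrix power2_norm_eq_inner
        matrix_vector_mul_assoc[symmetric]
        inner_vector_matrix inner_commute[of "_ *v _" "\<eta> _"] inner_commute[of x "\<eta> _"]
        inner_commute[of x "q _"])
qed

lemma gain_denominator_inner:
  "v \<bullet> ((transpose B ** P ** B + mat 1) *v v) = (B *v v) \<bullet> (P *v (B *v v)) + v \<bullet> v"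
  for B :: "real^'m^'n"
  by (simp add: algebra_simps inner_simps matrix_vector_mul_assoc[symmetric]
      inner_vector_matrix dot_lmul_matrix)

lemma transpose_add: "transpose (X + Y) = transpose X + transpose (Y :: real^'k^'l)"
  by (simp add: transpose_def vec_eq_iff)

lemma transpose_diff: "transpose (X - Y) = transpose X - transpose (Y :: real^'k^'l)"
  by (simp add: transpose_def vec_eq_iff)

lemma pos_def_gain_denominator:
  fixes B :: "real^'m^'n"
  assumes "psd P"
  shows "pos_def (transpose B ** P ** B + mat 1)"
  unfolding pos_def_def symmetric_matrix_def
proof (intro conjI allI impI)
  show "transpose (transpose B ** P ** B + mat 1) = transpose B ** P ** B + mat 1"
    by (simp add: transpose_add matrix_transpose_mul psd_symmetric[OF assms] matrix_mul_assoc)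
  fix v :: "real^'m"
  assume "v \<noteq> 0"
  then show "0 < v \<bullet> ((transpose B ** P ** B + mat 1) *v v)"
    using assms unfolding gain_denominator_inner by (simp add: psd_def add_nonneg_pos)
qed

lemma pos_def_invertible:
  assumes "pos_def S"
  shows "invertible S"
proof -
  have "v = 0" if "S *v v = 0" for v
    using assms that by (metis inner_zero_right less_irrefl pos_def_def)
  then show ?thesis
    by (metis invertible_left_inverse matrix_left_invertible_ker)
qed

lemma matrix_inv_cancel:
  fixes S :: "real^'k^'k"
  assumes "invertible S"
  shows "S ** matrix_inv S = mat 1"
  using assms unfolding invertible_def matrix_inv_def by (metis (mono_tags, lifting) someI_ex)

lemma gain_equation:
  fixes A :: "real^'n^'n" and B :: "real^'m^'n"
  assumes "psd P"
  shows "(transpose B ** P ** B + mat 1) ** feedback_gain A B P = transpose B ** P ** A"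
  unfolding feedback_gain_def
  using matrix_inv_cancel[OF pos_def_invertible[OF pos_def_gain_denominator[OF assms, of B]]]
  by (simp add: matrix_mul_assoc)

text \<open>The right-hand form shows the gain as \<open>transpose B ** P\<close> times the
  closed-loop matrix, so that \<open>K\<close> determines \<open>transpose B ** P\<close> once that
  matrix is invertible.\<close>

lemma gain_equation_closed_loop:
  fixes A :: "real^'n^'n" and B :: "real^'m^'n"
  shows "(transpose B ** P ** B + mat 1) ** K = transpose B ** P ** A \<longleftrightarrow>
    K = transpose B ** P ** (A - B ** K)"
  by (auto simp: matrix_eq algebra_simps matrix_vector_mul_assoc[symmetric] eq_diff_eq add.commute)

text \<open>By the fixed-point equation a vector killed by \<open>A - B ** K\<close> is killed by
  \<open>K\<close>, hence by \<open>A\<close>.\<close>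

lemma invertible_closed_loop:
  fixes A :: "real^'n^'n" and B :: "real^'m^'n"
  assumes A: "invertible A" and K: "K = transpose B ** P ** (A - B ** K)"
  shows "invertible (A - B ** K)"
proof -
  have "x = 0" if x: "(A - B ** K) *v x = 0" for x
  proof -
    have "K *v x = transpose B ** P *v ((A - B ** K) *v x)"
      using K by (metis matrix_vector_mul_assoc)
    then have "K *v x = 0" by (simp add: x)
    then have "A *v x = 0"
      using x by (simp add: algebra_simps matrix_vector_mul_assoc[symmetric])
    then show "x = 0" using A by (metis invertible_left_inverse matrix_left_invertible_ker)
  qed
  then show ?thesis by (metis invertible_left_inverse matrix_left_invertible_ker)
qed

text \<open>The Riccati expression is a sum of nonnegative costs: with \<open>u = K *v x\<close> its
  form at \<open>x\<close> is the \<open>P\<close>-form of \<open>A *v x - B *v u\<close>, plus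
  \<open>u \<bullet> u\<close>, plus the \<open>Q\<close>-form of \<open>x\<close>.\<close>

lemma riccati_psd:
  fixes A :: "real^'n^'n" and B :: "real^'m^'n"
  assumes P: "psd P" and Q: "psd Q"
  shows "psd (transpose A ** P ** A + Q - transpose A ** P ** B ** feedback_gain A B P)"
proof -
  define K where "K = feedback_gain A B P"
  define R where "R = transpose B ** P ** B + mat 1"
  have RK: "R ** K = transpose B ** P ** A"
    unfolding R_def K_def by (rule gain_equation[OF P])
  have tR: "transpose R = R" unfolding R_def by (rule pos_def_symmetric[OF pos_def_gain_denominator[OF P]])
  have "transpose A ** P ** B = transpose (R ** K)"
    unfolding RK by (simp add: matrix_transpose_mul psd_symmetric[OF P] matrix_mul_assoc)
  then have APB: "transpose A ** P ** B = transpose K ** R"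
    by (simp add: matrix_transpose_mul tR)
  have "0 \<le> x \<bullet> ((transpose A ** P ** A + Q - transpose K ** R ** K) *v x)" for x
  proof -
    define u where "u = K *v x"
    define Y where "Y = (A *v x) \<bullet> (P *v (B *v u))"
    have Ru: "u \<bullet> (R *v u) = (B *v u) \<bullet> (P *v (B *v u)) + u \<bullet> u"
      unfolding R_def by (rule gain_denominator_inner)
    have "R *v u = transpose B ** P ** A *v x"
      unfolding u_def matrix_vector_mul_assoc RK ..
    then have "u \<bullet> (R *v u) = (B *v u) \<bullet> (P *v (A *v x))"
      by (simp add: matrix_vector_mul_assoc[symmetric] inner_vector_matrix dot_lmul_matrix)
    also have "\<dots> = Y"
      unfolding Y_def by (rule inner_symmetric_matrix[OF psd_symmetric[OF P]])
    finally have uRu: "u \<bullet> (R *v u) = Y" .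
    have sym: "(B *v u) \<bullet> (P *v (A *v x)) = Y"
      unfolding Y_def by (rule inner_symmetric_matrix[OF psd_symmetric[OF P]])
    have "0 \<le> (A *v x - B *v u) \<bullet> (P *v (A *v x - B *v u)) + u \<bullet> u + x \<bullet> (Q *v x)"
      using P Q by (simp add: psd_def)
    also have "\<dots> = (A *v x) \<bullet> (P *v (A *v x)) + x \<bullet> (Q *v x) - u \<bullet> (R *v u)"
      using Ru uRu sym by (simp add: algebra_simps inner_simps Y_def)
    also have "\<dots> = x \<bullet> ((transpose A ** P ** A + Q - transpose K ** R ** K) *v x)"
      by (simp add: algebra_simps inner_simps matrix_vector_mul_assoc[symmetric] u_def
          inner_vector_matrix dot_lmul_matrix)
    finally show ?thesis .
  qed
  moreover have "transpose (transpose A ** P ** A + Q - transpose K ** R ** K)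
      = transpose A ** P ** A + Q - transpose K ** R ** K"
    by (simp add: transpose_add transpose_diff matrix_transpose_mul psd_symmetric[OF P]
        psd_symmetric[OF Q] tR matrix_mul_assoc)
  ultimately show ?thesis
    unfolding K_def[symmetric] APB by (simp add: psd_def symmetric_matrix_def)
qed

definition feedback_offset :: "real^'m^'n \<Rightarrow> real^'n^'n \<Rightarrow> real^'n \<Rightarrow> real^'m" where
  "feedback_offset B P \<eta> = matrix_inv (transpose B ** P ** B + mat 1) *v (transpose B *v \<eta>)"

lemma offset_equation:
  fixes B :: "real^'m^'n"
  assumes "psd P"
  shows "(transpose B ** P ** B + mat 1) *v feedback_offset B P \<eta> = transpose B *v \<eta>"
  unfolding feedback_offset_def matrix_vector_mul_assoc
  using matrix_inv_cancel[OF pos_def_invertible[OF pos_def_gain_denominator[OF assms, of B]]]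
  by (simp add: matrix_mul_assoc)

text \<open>The least corner entry \<open>\<xi>\<close> for which the constraint matrix of a Riccati solution is positive
  semidefinite, i.e. the one with vanishing Schur complement.\<close>

definition schur_corner :: "real^'m^'n \<Rightarrow> real^'n^'n \<Rightarrow> real^'n \<Rightarrow> real" where
  "schur_corner B P \<eta> = feedback_offset B P \<eta> \<bullet>
     ((transpose B ** P ** B + mat 1) *v feedback_offset B P \<eta>)"

lemma cross_block_factor:
  fixes A :: "real^'n^'n" and B :: "real^'m^'n"
  assumes "psd P"
  shows "transpose A ** P ** B = transpose (feedback_gain A B P) ** (transpose B ** P ** B + mat 1)"
proof -
  have "transpose A ** P ** B = transpose ((transpose B ** P ** B + mat 1) ** feedback_gain A B P)"
    unfolding gain_equation[OF assms]
    by (simp add: matrix_transpose_mul psd_symmetric[OF assms] matrix_mul_assoc)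
  then show ?thesis
    by (simp add: matrix_transpose_mul pos_def_symmetric[OF pos_def_gain_denominator[OF assms]])
qed

text \<open>The Riccati equations make every block factor through \<open>R\<close>: the matrix is
  \<open>C\<^sup>T R C\<close> with the block row \<open>C = (I, K, k)\<close>. The last entry
  \<open>c\<close> is kept general because semidefiniteness concerns all vectors, not only those
  ending in 1.\<close>

lemma lmi_matrix_riccati:
  fixes A :: "real^'n^'n" and B :: "real^'m^'n"
  assumes P: "psd (P (t + 1))"
    and Pt: "P t = transpose A ** P (t + 1) ** A + Q
              - transpose A ** P (t + 1) ** B ** feedback_gain A B (P (t + 1))"
    and \<eta>t: "\<eta> t = transpose (A - B ** feedback_gain A B (P (t + 1))) *v \<eta> (t + 1) + q t"
    and \<xi>t: "\<xi> t = schur_corner B (P (t + 1)) (\<eta> (t + 1))"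
  defines "K \<equiv> feedback_gain A B (P (t + 1))"
    and "k \<equiv> feedback_offset B (P (t + 1)) (\<eta> (t + 1))"
    and "R \<equiv> transpose B ** P (t + 1) ** B + mat 1"
  shows "block_vec3 u x c \<bullet> (lmi_matrix A B (Q, q, P, \<eta>, \<xi>) t *v block_vec3 u x c) =
      (u + K *v x + c *\<^sub>R k) \<bullet> (R *v (u + K *v x + c *\<^sub>R k))"
    and "psd (lmi_matrix A B (Q, q, P, \<eta>, \<xi>) t)"
proof -
  have tR: "transpose R = R"
    unfolding R_def by (rule pos_def_symmetric[OF pos_def_gain_denominator[OF P]])
  have RK: "transpose B ** P (t + 1) ** A = R ** K"
    unfolding R_def K_def by (rule gain_equation[OF P, symmetric])
  have KR: "transpose A ** P (t + 1) ** B = transpose K ** R"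
    unfolding R_def K_def by (rule cross_block_factor[OF P])
  have Rk: "transpose B *v \<eta> (t + 1) = R *v k"
    unfolding R_def k_def by (rule offset_equation[OF P, symmetric])
  have W: "transpose A ** P (t + 1) ** A + Q - P t = transpose K ** R ** K"
    unfolding Pt KR K_def[symmetric] by simp
  have "\<eta> t = (transpose A - transpose K ** transpose B) *v \<eta> (t + 1) + q t"
    unfolding \<eta>t K_def[symmetric] by (simp add: transpose_diff matrix_transpose_mul)
  then have \<beta>: "q t + transpose A *v \<eta> (t + 1) - \<eta> t = transpose K *v (R *v k)"
    unfolding Rk[symmetric]
    by (simp add: matrix_vector_mult_diff_rdistrib matrix_vector_mul_assoc del: transpose_matrix_vector)
  have L: "lmi_matrix A B (Q, q, P, \<eta>, \<xi>) t =
      block_matrix3 R (R ** K) (R *v k) (transpose K ** R) (transpose K ** R ** K)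
        (transpose K *v (R *v k)) (R *v k) (transpose K *v (R *v k)) (k \<bullet> (R *v k))"
    using Rk unfolding lmi_matrix_def
    by (simp add: Let_def RK[simplified] KR[simplified] W[simplified] \<beta>[simplified] \<xi>t schur_corner_def R_def[simplified, symmetric]
       k_def[simplified, symmetric])
  have inner_R: "a \<bullet> (R *v b) = b \<bullet> (R *v a)" for a b
    by (rule inner_symmetric_matrix[OF tR])
  have form: "block_vec3 u x c \<bullet> (lmi_matrix A B (Q, q, P, \<eta>, \<xi>) t *v block_vec3 u x c) =
      (u + K *v x + c *\<^sub>R k) \<bullet> (R *v (u + K *v x + c *\<^sub>R k))" for u x c
    unfolding L block_matrix3_mult_block_vec3 inner_block_vec3
    using inner_R[of "K *v x" u] inner_R[of k u] inner_R[of k "K *v x"]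
    by (simp add: algebra_simps inner_simps matrix_vector_mul_assoc[symmetric] dot_lmul_matrix
        inner_vector_matrix matrix_vector_mult_scaleR power2_eq_square
        inner_commute[of "R *v k"])
  show "block_vec3 u x c \<bullet> (lmi_matrix A B (Q, q, P, \<eta>, \<xi>) t *v block_vec3 u x c) =
      (u + K *v x + c *\<^sub>R k) \<bullet> (R *v (u + K *v x + c *\<^sub>R k))"
    by (rule form)
  have "0 \<le> z \<bullet> (lmi_matrix A B (Q, q, P, \<eta>, \<xi>) t *v z)" for z
    using gain_denominator_inner[of _ B "P (t + 1)"] P
    by (cases z rule: block_vec3_cases) (simp add: form psd_def R_def)
  moreover have "transpose (lmi_matrix A B (Q, q, P, \<eta>, \<xi>) t) = lmi_matrix A B (Q, q, P, \<eta>, \<xi>) t"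
    unfolding L by (simp add: transpose_block_matrix3 matrix_transpose_mul tR matrix_mul_assoc)
  ultimately show "psd (lmi_matrix A B (Q, q, P, \<eta>, \<xi>) t)"
    by (simp add: psd_def symmetric_matrix_def)
qed

lemma riccati_iterations_psd:
  assumes ric: "riccati_iterations A B T Q q P \<eta>" and Q: "psd Q" and t: "1 \<le> t" "t \<le> T"
  shows "psd (P t)"
  using t(2)
proof (induction rule: inc_induct)
  case base
  then show ?case using ric Q by (simp add: riccati_iterations_def)
next
  case (step s)
  then show ?case
    using ric t(1) riccati_psd[OF step.IH Q, of A B] by (simp add: riccati_iterations_def)
qed

section \<open>Recovering the parameter from the feedback gains\<close>

lemma controllable_annihilates:
  fixes A :: "real^'n^'n" and B :: "real^'m^'n" and D :: "real^'n^'n"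
  assumes "controllable A B"
    and D: "\<And>k. k < CARD('n) \<Longrightarrow> D ** (((\<lambda>X. A ** X) ^^ k) B) = 0"
  shows "D = 0"
proof -
  let ?C = "\<Union>k<CARD('n). columns (((\<lambda>X. A ** X) ^^ k) B)"
  have span: "span ?C = UNIV"
    using assms(1) dim_eq_full[of ?C] by (simp add: controllable_def)
  have "D *v c = 0" if "c \<in> ?C" for c
  proof -
    from that obtain k i where k: "k < CARD('n)" and c: "c = column i (((\<lambda>X. A ** X) ^^ k) B)"
      by (auto simp: columns_def)
    show ?thesis
      unfolding c matrix_vector_mult_basis[symmetric] matrix_vector_mul_assoc D[OF k] by simp
  qed
  then have "D *v y = 0" for y
    using linear_eq_0_on_span[of "(*v) D" ?C y] span by auto
  then show ?thesis by (simp add: matrix_eq)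
qed

text \<open>The deterministic core of uniqueness. The gains of \<open>P'\<close> also solve the gain
  equations of \<open>P\<close>; the difference \<open>D\<close> then annihilates \<open>B\<close>,
  and each step toward the final time adds one more power of \<open>A\<close>, until the
  controllability matrix is exhausted at time \<open>T\<close>.\<close>

lemma common_gains_imp_equal_riccati:
  fixes A :: "real^'n^'n" and B :: "real^'m^'n"
  assumes ctrl: "controllable A B" and inv: "invertible A" and T: "CARD('n) + 1 \<le> T"
    and ric: "riccati_iterations A B T Q' q' P' \<eta>'" and Q': "psd Q'"
    and sym: "\<And>t. t \<in> {1..T} \<Longrightarrow> transpose (P t) = P t"
    and PT: "P T = Q"
    and gain: "\<And>t. t \<in> {1..<T} \<Longrightarrow>
      (transpose B ** P (t + 1) ** B + mat 1) ** feedback_gain A B (P' (t + 1))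
        = transpose B ** P (t + 1) ** A"
    and step: "\<And>t. t \<in> {1..<T} \<Longrightarrow> P t = transpose A ** P (t + 1) ** A + Q
        - transpose A ** P (t + 1) ** B ** feedback_gain A B (P' (t + 1))"
  shows "Q = Q'" and "\<And>t. t \<in> {1..T} \<Longrightarrow> P t = P' t"
proof -
  define D where "D t = P t - P' t" for t
  have psd: "psd (P' t)" if "t \<in> {1..T}" for t
    using riccati_iterations_psd[OF ric Q'] that by simp
  have P'T: "P' T = Q'" using ric by (simp add: riccati_iterations_def)
  have DB: "D (t + 1) ** B = 0" if t: "t \<in> {1..<T}" for t
  proof -
    define K where "K = feedback_gain A B (P' (t + 1))"
    have psd': "psd (P' (t + 1))" using psd t by simp
    have 1: "K = transpose B ** P' (t + 1) ** (A - B ** K)"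
      using gain_equation[OF psd', of B A] gain_equation_closed_loop K_def by blast
    have 2: "K = transpose B ** P (t + 1) ** (A - B ** K)"
      using gain[OF t] gain_equation_closed_loop K_def by blast
    \<comment> \<open>Cancelling the closed-loop matrix on the right expresses both products as
      \<open>K ** Z\<close>.\<close>
    obtain Z where Z: "(A - B ** K) ** Z = mat 1"
      using invertible_closed_loop[OF inv 1] unfolding invertible_def by blast
    have "transpose B ** P (t + 1) = K ** Z"
      using 2 Z by (metis matrix_mul_assoc matrix_mul_rid)
    moreover have "transpose B ** P' (t + 1) = K ** Z"
      using 1 Z by (metis matrix_mul_assoc matrix_mul_rid)
    ultimately have "transpose (transpose B ** P (t + 1)) = transpose (transpose B ** P' (t + 1))"
      by simp
    then have "P (t + 1) ** B = P' (t + 1) ** B"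
      using sym[of "t + 1"] psd_symmetric[OF psd'] t by (simp add: matrix_transpose_mul)
    then show ?thesis
      by (simp add: D_def matrix_eq algebra_simps matrix_vector_mul_assoc[symmetric])
  qed
  \<comment> \<open>The same gain multiplies the same matrix \<open>P (t + 1) ** B\<close> in both
    recursions, so these terms drop out of the difference.\<close>
  have Dstep: "D t = transpose A ** D (t + 1) ** A + (Q - Q')" if t: "t \<in> {1..<T}" for t
  proof -
    have "P (t + 1) ** B = P' (t + 1) ** B"
      using DB[OF t] by (simp add: D_def matrix_eq algebra_simps matrix_vector_mul_assoc[symmetric])
    then have "transpose A ** P (t + 1) ** B = transpose A ** P' (t + 1) ** B"
      by (metis matrix_mul_assoc)
    moreover have "P' t = transpose A ** P' (t + 1) ** A + Q'
        - transpose A ** P' (t + 1) ** B ** feedback_gain A B (P' (t + 1))"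
      using ric t by (simp add: riccati_iterations_def)
    moreover have "transpose A ** D (t + 1) ** A
        = transpose A ** P (t + 1) ** A - transpose A ** P' (t + 1) ** A"
      by (simp add: D_def matrix_eq algebra_simps matrix_vector_mul_assoc[symmetric])
    ultimately show ?thesis
      using step[OF t] by (simp add: D_def)
  qed
  define C where "C i = ((\<lambda>X. A ** X) ^^ i) B" for i
  \<comment> \<open>The induction hypothesis is used at two times: at \<open>t - 1\<close> for
    \<open>D\<close> itself, and at \<open>T\<close>, where \<open>D T = Q - Q'\<close> removes the
    inhomogeneous term. What is left is \<open>transpose A ** D t ** A ** C i = 0\<close>, and
    \<open>transpose A\<close> cancels. The range begins at \<open>i + 2\<close> because the gain
    equations involve \<open>P\<close> from time 2 on.\<close>
  have DC: "\<forall>t. i + 2 \<le> t \<and> t \<le> T \<longrightarrow> D t ** C i = 0" for i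
  proof (induction i)
    case 0
    show ?case
    proof (intro allI impI)
      fix t assume "0 + 2 \<le> t \<and> t \<le> T"
      then show "D t ** C 0 = 0" using DB[of "t - 1"] by (cases t) (auto simp: C_def)
    qed
  next
    case (Suc i)
    show ?case
    proof (intro allI impI)
      fix t assume t: "Suc i + 2 \<le> t \<and> t \<le> T"
      then obtain s where s: "t = s + 1" "i + 2 \<le> s" "s < T"
        by (cases t) auto
      have "D s ** C i = 0" "(Q - Q') ** C i = 0"
        using Suc.IH[rule_format, of s] Suc.IH[rule_format, of T] s by (simp_all add: D_def PT P'T)
      moreover have "D s ** C i = transpose A ** (D t ** C (Suc i)) + (Q - Q') ** C i"
        using Dstep[of s] s
        by (simp add: C_def matrix_eq matrix_vector_mult_add_rdistrib matrix_vector_mul_assoc[symmetric])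
      ultimately have "transpose A ** (D t ** C (Suc i)) = 0" by simp
      moreover have "\<exists>Z. Z ** transpose A = mat 1"
        using transpose_invertible[OF inv] by (auto simp: invertible_def)
      ultimately show "D t ** C (Suc i) = 0"
        by (metis matrix_mul_assoc matrix_mul_lid times0_right)
    qed
  qed
  have "Q - Q' = 0"
  proof (rule controllable_annihilates[OF ctrl])
    \<comment> \<open>The horizon bound is exactly what makes \<open>k + 2 \<le> T\<close> for every
      \<open>k < CARD('n)\<close>.\<close>
    fix k assume "k < CARD('n)"
    then show "(Q - Q') ** ((\<lambda>X. A ** X) ^^ k) B = 0"
      using DC[of k, rule_format, of T] T by (simp add: C_def D_def PT P'T)
  qed
  then show Q: "Q = Q'" by simp
  fix t assume t: "t \<in> {1..T}"
  have "t \<le> T" using t by simp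
  then have "D t = 0"
  proof (induction rule: inc_induct)
    case base
    then show ?case by (simp add: D_def PT P'T Q)
  next
    case (step s)
    then show ?case using Dstep[of s] t by (simp add: Q)
  qed
  then show "P t = P' t" by (simp add: D_def)
qed

section \<open>Square-integrable random vectors\<close>

definition square_integrable :: "'a measure \<Rightarrow> ('a \<Rightarrow> 'b::euclidean_space) \<Rightarrow> bool" where
  "square_integrable M f \<longleftrightarrow> f \<in> borel_measurable M \<and> integrable M (\<lambda>\<omega>. (norm (f \<omega>))\<^sup>2)"

lemma square_integrable_measurable: "square_integrable M f \<Longrightarrow> f \<in> borel_measurable M"
  by (simp add: square_integrable_def)

lemma square_integrable_bound:
  assumes "square_integrable M f" and [measurable]: "g \<in> borel_measurable M"
    and le: "\<And>\<omega>. norm (g \<omega>) \<le> c * norm (f \<omega>)"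
  shows "square_integrable M g"
proof -
  have "integrable M (\<lambda>\<omega>. c\<^sup>2 * (norm (f \<omega>))\<^sup>2)"
    using assms(1) by (simp add: square_integrable_def)
  moreover have "norm ((norm (g \<omega>))\<^sup>2) \<le> norm (c\<^sup>2 * (norm (f \<omega>))\<^sup>2)" for \<omega>
    using power_mono[OF le[of \<omega>], of 2] by (simp add: power_mult_distrib)
  moreover have "(\<lambda>\<omega>. (norm (g \<omega>))\<^sup>2) \<in> borel_measurable M" by measurable
  ultimately have "integrable M (\<lambda>\<omega>. (norm (g \<omega>))\<^sup>2)"
    by (metis (no_types, lifting) Bochner_Integration.integrable_bound AE_I2)
  then show ?thesis by (simp add: square_integrable_def)
qed

lemma square_integrable_add:
  assumes "square_integrable M f" "square_integrable M g"
  shows "square_integrable M (\<lambda>\<omega>. f \<omega> + g \<omega>)"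
proof -
  have [measurable]: "f \<in> borel_measurable M" "g \<in> borel_measurable M"
    using assms by (simp_all add: square_integrable_def)
  have "integrable M (\<lambda>\<omega>. 2 * (norm (f \<omega>))\<^sup>2 + 2 * (norm (g \<omega>))\<^sup>2)"
    using assms by (simp add: square_integrable_def)
  moreover have "norm ((norm (f \<omega> + g \<omega>))\<^sup>2) \<le> norm (2 * (norm (f \<omega>))\<^sup>2 + 2 * (norm (g \<omega>))\<^sup>2)" for \<omega>
  proof -
    have "0 \<le> (norm (f \<omega> - g \<omega>))\<^sup>2" by simp
    then have "(norm (f \<omega> + g \<omega>))\<^sup>2 \<le> 2 * (norm (f \<omega>))\<^sup>2 + 2 * (norm (g \<omega>))\<^sup>2"
      by (simp add: power2_norm_eq_inner inner_simps inner_commute)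
    then show ?thesis by simp
  qed
  moreover have "(\<lambda>\<omega>. (norm (f \<omega> + g \<omega>))\<^sup>2) \<in> borel_measurable M" by measurable
  ultimately have "integrable M (\<lambda>\<omega>. (norm (f \<omega> + g \<omega>))\<^sup>2)"
    by (metis (no_types, lifting) Bochner_Integration.integrable_bound AE_I2)
  then show ?thesis by (simp add: square_integrable_def)
qed

lemma square_integrable_inner:
  assumes "square_integrable M f" "square_integrable M g"
  shows "integrable M (\<lambda>\<omega>. f \<omega> \<bullet> g \<omega>)"
proof -
  have [measurable]: "f \<in> borel_measurable M" "g \<in> borel_measurable M"
    using assms by (simp_all add: square_integrable_def)
  have "integrable M (\<lambda>\<omega>. (norm (f \<omega> + g \<omega>))\<^sup>2)" "integrable M (\<lambda>\<omega>. (norm (f \<omega>))\<^sup>2)"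
    "integrable M (\<lambda>\<omega>. (norm (g \<omega>))\<^sup>2)"
    using assms square_integrable_add[OF assms] by (simp_all add: square_integrable_def)
  then have "integrable M (\<lambda>\<omega>. ((norm (f \<omega> + g \<omega>))\<^sup>2 - (norm (f \<omega>))\<^sup>2 - (norm (g \<omega>))\<^sup>2) / 2)"
    by simp
  then show ?thesis by (simp add: dot_norm)
qed

lemma measurable_matrix_vector_mult [measurable (raw)]:
  fixes C :: "real^'k^'l"
  assumes "f \<in> borel_measurable M"
  shows "(\<lambda>\<omega>. C *v f \<omega>) \<in> borel_measurable M"
proof -
  have "(*v) C \<in> borel_measurable borel"
    by (intro borel_measurable_continuous_onI linear_continuous_on)
       (simp add: matrix_vector_mul_bounded_linear)
  from measurable_compose[OF assms this] show ?thesis .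
qed

lemma measurable_vec_nth [measurable (raw)]:
  fixes f :: "'a \<Rightarrow> real^'k"
  assumes "f \<in> borel_measurable M"
  shows "(\<lambda>\<omega>. f \<omega> $ i) \<in> borel_measurable M"
proof -
  have "(\<lambda>v::real^'k. v $ i) \<in> borel_measurable borel"
    by (intro borel_measurable_continuous_onI continuous_intros)
  from measurable_compose[OF assms this] show ?thesis .
qed

lemma square_integrable_matrix_vector_mult:
  fixes C :: "real^'k^'l"
  assumes "square_integrable M f"
  shows "square_integrable M (\<lambda>\<omega>. C *v f \<omega>)"
proof (rule square_integrable_bound[OF assms])
  show "(\<lambda>\<omega>. C *v f \<omega>) \<in> borel_measurable M"
    using square_integrable_measurable[OF assms] by measurable
  show "norm (C *v f \<omega>) \<le> onorm ((*v) C) * norm (f \<omega>)" for \<omega>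
    by (rule onorm) simp
qed

lemma square_integrable_vec_nth:
  fixes f :: "'a \<Rightarrow> real^'k"
  assumes "square_integrable M f"
  shows "square_integrable M (\<lambda>\<omega>. f \<omega> $ i)"
proof (rule square_integrable_bound[OF assms])
  show "(\<lambda>\<omega>. f \<omega> $ i) \<in> borel_measurable M"
    using square_integrable_measurable[OF assms] by measurable
  show "norm (f \<omega> $ i) \<le> 1 * norm (f \<omega>)" for \<omega>
    using component_le_norm_cart[of "f \<omega>" i] by simp
qed

lemma (in finite_measure) square_integrable_const: "square_integrable M (\<lambda>_. c)"
  by (simp add: square_integrable_def)

lemma (in finite_measure) square_integrable_integrable:
  assumes "square_integrable M f"
  shows "integrable M f"
proof -
  have [measurable]: "f \<in> borel_measurable M"
    using assms by (simp add: square_integrable_def)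
  have "integrable M (\<lambda>\<omega>. 1 + (norm (f \<omega>))\<^sup>2)"
    using assms by (simp add: square_integrable_def)
  moreover have "norm (f \<omega>) \<le> norm (1 + (norm (f \<omega>))\<^sup>2)" for \<omega>
    using zero_le_power2[of "norm (f \<omega>) - 1"] unfolding power2_diff
    by simp (use norm_ge_zero[of "f \<omega>"] in linarith)
  moreover note \<open>f \<in> borel_measurable M\<close>
  ultimately show ?thesis
    by (metis (no_types, lifting) Bochner_Integration.integrable_bound AE_I2)
qed

lemma (in finite_measure) integrable_quadratic_value:
  assumes "square_integrable M f"
  shows "integrable M (\<lambda>\<omega>. quadratic_value P \<eta> (f \<omega>))"
  unfolding quadratic_value_def
  by (intro Bochner_Integration.integrable_add integrable_mult_right square_integrable_inner assms
      square_integrable_matrix_vector_mult square_integrable_const)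

text \<open>An affine relation makes \<open>v \<bullet> X\<close> almost surely constant, so the
  centred vector \<open>Y\<close> is orthogonal to \<open>v\<close>. The covariance matrix applied
  to \<open>v\<close> is the expectation of \<open>Y\<close> times \<open>Y \<bullet> v\<close>,
  hence zero.\<close>

lemma (in prob_space) covariance_pos_def_nondegenerate:
  fixes X :: "'a \<Rightarrow> real^'k"
  assumes X: "square_integrable M X" and cov: "pos_def (covariance_matrix M X X)"
    and AE: "AE \<omega> in M. v \<bullet> X \<omega> + c = 0"
  shows "v = 0"
proof -
  define Y where "Y \<omega> = X \<omega> - expectation X" for \<omega>
  have Xi: "integrable M X" by (rule square_integrable_integrable[OF X])
  have "expectation (\<lambda>\<omega>. v \<bullet> X \<omega>) = expectation (\<lambda>_. - c)"
    using AE Xi by (intro integral_cong_AE) (auto simp: eq_neg_iff_add_eq_0)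
  then have "v \<bullet> expectation X = - c"
    using Xi prob_space by simp
  then have vY: "AE \<omega> in M. v \<bullet> Y \<omega> = 0"
    using AE by (auto simp: Y_def inner_diff_right)
  have Y: "square_integrable M Y"
    using square_integrable_add[OF X square_integrable_const[of "- expectation X"]]
    by (simp add: Y_def[abs_def])
  have Yij: "integrable M (\<lambda>\<omega>. Y \<omega> $ i * Y \<omega> $ j)" for i j
    using square_integrable_inner[OF square_integrable_vec_nth[OF Y] square_integrable_vec_nth[OF Y]]
    by simp
  have "(covariance_matrix M X X *v v) $ i = 0" for i
  proof -
    have "(covariance_matrix M X X *v v) $ i = (\<Sum>j\<in>UNIV. expectation (\<lambda>\<omega>. Y \<omega> $ i * Y \<omega> $ j * v $ j))"
      using Yij by (simp add: matrix_vector_mult_def covariance_matrix_def Y_def)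
    also have "\<dots> = expectation (\<lambda>\<omega>. \<Sum>j\<in>UNIV. Y \<omega> $ i * Y \<omega> $ j * v $ j)"
      using Yij by (intro Bochner_Integration.integral_sum[symmetric]) simp
    also have "\<dots> = expectation (\<lambda>_. 0)"
    proof (rule integral_cong_AE)
      show "(\<lambda>\<omega>. \<Sum>j\<in>UNIV. Y \<omega> $ i * Y \<omega> $ j * v $ j) \<in> borel_measurable M"
        using square_integrable_measurable[OF Y] by measurable
      show "AE \<omega> in M. (\<Sum>j\<in>UNIV. Y \<omega> $ i * Y \<omega> $ j * v $ j) = 0"
        using vY
      proof (rule AE_mp, intro AE_I2 impI)
        fix \<omega> assume "v \<bullet> Y \<omega> = 0"
        then have "Y \<omega> $ i * (v \<bullet> Y \<omega>) = 0" by simp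
        then show "(\<Sum>j\<in>UNIV. Y \<omega> $ i * Y \<omega> $ j * v $ j) = 0"
          by (simp add: inner_vec_def sum_distrib_left algebra_simps)
      qed
    qed simp
    finally show ?thesis by simp
  qed
  then have "covariance_matrix M X X *v v = 0" by (simp add: vec_eq_iff)
  then show ?thesis
    using cov unfolding pos_def_def by (metis inner_zero_right less_irrefl)
qed

lemma (in prob_space) square_integrable_uniform_measure:
  assumes X: "square_integrable M X" and E: "E \<in> sets M" "prob E > 0"
  shows "square_integrable (uniform_measure M E) X"
  unfolding square_integrable_def
proof
  have [measurable]: "X \<in> borel_measurable M" using X by (simp add: square_integrable_def)
  show Xm: "X \<in> borel_measurable (uniform_measure M E)"
    by simp
  let ?f = "\<lambda>\<omega>. ennreal (norm ((norm (X \<omega>))\<^sup>2))"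
  have "(\<integral>\<^sup>+\<omega>. ?f \<omega> * indicator E \<omega> \<partial>M) \<le> (\<integral>\<^sup>+\<omega>. ?f \<omega> \<partial>M)"
    by (rule nn_integral_mono) (simp split: split_indicator)
  also have "\<dots> < \<infinity>"
    using X by (simp add: square_integrable_def integrable_iff_bounded)
  finally have "(\<integral>\<^sup>+\<omega>. ?f \<omega> * indicator E \<omega> \<partial>M) \<noteq> \<infinity>" by simp
  moreover have "emeasure M E \<noteq> 0" using E by (simp add: emeasure_eq_measure)
  ultimately have "(\<integral>\<^sup>+\<omega>. ?f \<omega> * indicator E \<omega> \<partial>M) / emeasure M E < \<infinity>"
    by (metis ennreal_divide_eq_top_iff infinity_ennreal_def less_top)
  then show "integrable (uniform_measure M E) (\<lambda>\<omega>. (norm (X \<omega>))\<^sup>2)"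
    using E by (simp add: integrable_iff_bounded nn_integral_uniform_measure)
qed

section \<open>The controlled process\<close>

text \<open>\<open>T\<close> is the final time. Subtraction on \<open>nat\<close> is truncated, so a
  horizon above \<open>T\<close> also starts at time 1, while a horizon 0 would start at
  \<open>T + 1\<close>, outside the recursion; \<open>N_bounds\<close> makes the latter a null
  event.\<close>

locale random_horizon_control = prob_space M for M :: "'a measure" +
  fixes A :: "real^'n^'n" and B :: "real^'m^'n" and T :: nat and \<Sigma>w :: "real^'m^'m"
    and xbar :: "'a \<Rightarrow> real^'n" and N :: "'a \<Rightarrow> nat" and w :: "nat \<Rightarrow> 'a \<Rightarrow> real^'m"
  assumes T_pos: "1 \<le> T"
    and xbar_measurable [measurable]: "xbar \<in> borel_measurable M"
    and N_measurable [measurable]: "N \<in> measurable M (count_space UNIV)"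
    and w_measurable: "1 \<le> t \<Longrightarrow> w t \<in> borel_measurable M"
    and N_bounds: "AE \<omega> in M. 1 \<le> N \<omega>"
    and independent: "independent_inputs M xbar N w"
    and w_norm_integrable: "1 \<le> t \<Longrightarrow> integrable M (\<lambda>\<omega>. (norm (w t \<omega>))\<^sup>2)"
    and w_mean: "1 \<le> t \<Longrightarrow> (\<integral>\<omega>. w t \<omega> \<partial>M) = 0"
    and w_covariance: "1 \<le> t \<Longrightarrow> covariance_matrix M (w t) (w t) = \<Sigma>w"
    and xbar_norm_integrable: "integrable M (\<lambda>\<omega>. (norm (xbar \<omega>))\<^sup>2)"
begin

section \<open>Information up to time t and independence of the noise\<close>

abbreviation "F t \<equiv> information M xbar N w t"

lemma initial_pair_measurable: "(\<lambda>\<omega>. (xbar \<omega>, N \<omega>)) \<in> M \<rightarrow>\<^sub>M borel \<Otimes>\<^sub>M count_space UNIV"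
  by measurable

lemma subalgebra_initial: "subalgebra M (initial_sigma M xbar N)"
  unfolding subalgebra_def initial_sigma_def
  using measurable_sets[OF initial_pair_measurable] by (auto simp: sets_vimage_algebra2 space_pair_measure)

lemma sets_noise_sigma: "1 \<le> t \<Longrightarrow> sets (noise_sigma M w t) \<subseteq> sets M"
  unfolding noise_sigma_def using measurable_sets[OF w_measurable] by (auto simp: sets_vimage_algebra2)

lemma space_noise_sigma [simp]: "space (noise_sigma M w t) = space M"
  by (simp add: noise_sigma_def)

lemma space_initial_sigma [simp]: "space (initial_sigma M xbar N) = space M"
  by (simp add: initial_sigma_def)

lemma space_information [simp]: "space (F t) = space M"
  by (simp add: information_def space_measure_of_conv)

lemma information_generator_subset:
  "sets (initial_sigma M xbar N) \<union> (\<Union>s\<in>{1..<t}. sets (noise_sigma M w s)) \<subseteq> sets M"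
proof (intro Un_least UN_least)
  show "sets (initial_sigma M xbar N) \<subseteq> sets M"
    using subalgebra_initial by (simp add: subalgebra_def)
  show "sets (noise_sigma M w s) \<subseteq> sets M" if "s \<in> {1..<t}" for s
    using sets_noise_sigma that by simp
qed

lemma sets_information:
  "sets (F t) = sigma_sets (space M)
     (sets (initial_sigma M xbar N) \<union> (\<Union>s\<in>{1..<t}. sets (noise_sigma M w s)))"
  unfolding information_def
  using information_generator_subset sets.space_closed[of M] by (intro sets_measure_of) blast

lemma subalgebra_information: "subalgebra M (F t)"
  unfolding subalgebra_def sets_information
  using sets.sigma_sets_subset[OF information_generator_subset] by simp

lemma information_measurableD: "f \<in> borel_measurable (F t) \<Longrightarrow> f \<in> borel_measurable M"
  by (rule measurable_from_subalg[OF subalgebra_information])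

lemma information_mono: "s \<le> t \<Longrightarrow> subalgebra (F t) (F s)"
  unfolding subalgebra_def sets_information by (auto intro!: sigma_sets_mono')

lemma initial_information: "subalgebra (F t) (initial_sigma M xbar N)"
  unfolding subalgebra_def sets_information by auto

lemma initial_pair_information: "(\<lambda>\<omega>. (xbar \<omega>, N \<omega>)) \<in> F t \<rightarrow>\<^sub>M borel \<Otimes>\<^sub>M count_space UNIV"
proof (rule measurable_from_subalg[OF initial_information])
  show "(\<lambda>\<omega>. (xbar \<omega>, N \<omega>)) \<in> initial_sigma M xbar N \<rightarrow>\<^sub>M borel \<Otimes>\<^sub>M count_space UNIV"
    unfolding initial_sigma_def
    by (rule measurable_vimage_algebra1) (auto simp: space_pair_measure)
qed

lemma xbar_information [measurable]: "xbar \<in> borel_measurable (F t)"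
  using measurable_compose[OF initial_pair_information measurable_fst] by simp

lemma N_information [measurable]: "N \<in> measurable (F t) (count_space UNIV)"
  using measurable_compose[OF initial_pair_information measurable_snd] by simp

lemma w_information: "1 \<le> s \<Longrightarrow> s < t \<Longrightarrow> w s \<in> borel_measurable (F t)"
proof -
  assume s: "1 \<le> s" "s < t"
  have "subalgebra (F t) (noise_sigma M w s)"
    using s unfolding subalgebra_def sets_information by auto
  moreover have "w s \<in> borel_measurable (noise_sigma M w s)"
    unfolding noise_sigma_def by (rule measurable_vimage_algebra1) auto
  ultimately show ?thesis by (rule measurable_from_subalg)
qed

text \<open>Index 0 carries the pair \<open>(xbar, N)\<close>, so the generators of
  \<open>F t\<close> are the members of the independent family with index below \<open>t\<close>.
  Grouping the family into these and the single index \<open>t\<close> preserves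
  independence.\<close>

lemma indep_set_information:
  assumes t: "1 \<le> t"
  shows "indep_set (sets (F t)) (sets (noise_sigma M w t))"
proof -
  let ?E = "\<lambda>i. if i = 0 then sets (initial_sigma M xbar N) else sets (noise_sigma M w i)"
  have "indep_sets ?E UNIV"
    using independent unfolding independent_inputs_def .
  then have "indep_sets ?E (\<Union>j\<in>UNIV. case_bool {..<t} {t} j)"
    by (rule indep_sets_mono_index[rotated]) simp
  then have "indep_sets (\<lambda>j. sigma_sets (space M) (\<Union>i\<in>case_bool {..<t} {t} j. ?E i)) UNIV"
    by (rule indep_sets_collect_sigma)
       (auto simp: disjoint_family_on_def Int_stable_def split: bool.splits)
  moreover have "(\<Union>i\<in>{..<t}. ?E i)
      = sets (initial_sigma M xbar N) \<union> (\<Union>s\<in>{1..<t}. sets (noise_sigma M w s))"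
  proof -
    have "{..<t} = insert 0 {1..<t}" using t by auto
    then show ?thesis by (auto 0 3)
  qed
  ultimately show ?thesis
    using t unfolding indep_set_def sets_information
    by (elim indep_sets_mono_sets) (auto split: bool.splits)
qed

text \<open>All later uses of independence pass through this product rule: one factor is known at
  time \<open>t\<close>, the other is a function of the noise that acts at time
  \<open>t\<close>.\<close>

lemma
  fixes f :: "'a \<Rightarrow> real" and g :: "real^'m \<Rightarrow> real"
  assumes t: "1 \<le> t" and f: "f \<in> borel_measurable (F t)" "integrable M f"
    and g: "g \<in> borel_measurable borel" "integrable M (\<lambda>\<omega>. g (w t \<omega>))"
  shows integrable_past_times_noise: "integrable M (\<lambda>\<omega>. f \<omega> * g (w t \<omega>))"
    and expectation_past_times_noise:
      "(\<integral>\<omega>. f \<omega> * g (w t \<omega>) \<partial>M) = (\<integral>\<omega>. f \<omega> \<partial>M) * (\<integral>\<omega>. g (w t \<omega>) \<partial>M)"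
proof -
  have gw: "(\<lambda>\<omega>. g (w t \<omega>)) \<in> borel_measurable (noise_sigma M w t)"
    unfolding noise_sigma_def
    by (rule measurable_compose[OF measurable_vimage_algebra1 g(1)]) auto
  have "indep_var borel f borel (\<lambda>\<omega>. g (w t \<omega>))"
    unfolding indep_var_eq
  proof (intro conjI)
    show "f \<in> borel_measurable M" "(\<lambda>\<omega>. g (w t \<omega>)) \<in> borel_measurable M"
      using f(2) g(2) by auto
    have "sigma_sets (space M) {f -` S \<inter> space M |S. S \<in> sets borel} \<subseteq> sets (F t)"
      using sets.sigma_sets_subset[of "{f -` S \<inter> space M |S. S \<in> sets borel}" "F t"]
        measurable_sets[OF f(1)] by auto
    moreover have "sigma_sets (space M) {(\<lambda>\<omega>. g (w t \<omega>)) -` S \<inter> space M |S. S \<in> sets borel}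
        \<subseteq> sets (noise_sigma M w t)"
      using sets.sigma_sets_subset[of "{(\<lambda>\<omega>. g (w t \<omega>)) -` S \<inter> space M |S. S \<in> sets borel}"
          "noise_sigma M w t"] measurable_sets[OF gw] by auto
    ultimately show "indep_set (sigma_sets (space M) {f -` S \<inter> space M |S. S \<in> sets borel})
        (sigma_sets (space M) {(\<lambda>\<omega>. g (w t \<omega>)) -` S \<inter> space M |S. S \<in> sets borel})"
      using indep_set_information[OF t] unfolding indep_set_def
      by (elim indep_sets_mono_sets) (auto split: bool.splits)
  qed
  then show "integrable M (\<lambda>\<omega>. f \<omega> * g (w t \<omega>))"
    and "(\<integral>\<omega>. f \<omega> * g (w t \<omega>) \<partial>M) = (\<integral>\<omega>. f \<omega> \<partial>M) * (\<integral>\<omega>. g (w t \<omega>) \<partial>M)"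
    using f(2) g(2) indep_var_integrable indep_var_lebesgue_integral by blast+
qed

lemma square_integrable_w: "1 \<le> t \<Longrightarrow> square_integrable M (w t)"
  using w_measurable w_norm_integrable by (simp add: square_integrable_def)

lemma square_integrable_xbar: "square_integrable M xbar"
  using xbar_norm_integrable by (simp add: square_integrable_def)

lemma w_mean_component:
  assumes "1 \<le> t"
  shows "(\<integral>\<omega>. w t \<omega> $ i \<partial>M) = 0"
  using integral_bounded_linear[OF bounded_linear_vec_nth square_integrable_integrable[OF square_integrable_w[OF assms]], of i]
  by (simp add: w_mean[OF assms])

lemma w_second_moment:
  assumes "1 \<le> t"
  shows "(\<integral>\<omega>. w t \<omega> $ i * w t \<omega> $ j \<partial>M) = \<Sigma>w $ i $ j"
  using w_mean[OF assms] w_covariance[OF assms, symmetric] by (simp add: covariance_matrix_def)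

lemma
  fixes y :: "'a \<Rightarrow> real^'m"
  assumes t: "1 \<le> t" and y: "y \<in> borel_measurable (F t)" "square_integrable M y"
  shows integrable_past_inner_noise: "integrable M (\<lambda>\<omega>. y \<omega> \<bullet> w t \<omega>)"
    and expectation_past_inner_noise: "(\<integral>\<omega>. y \<omega> \<bullet> w t \<omega> \<partial>M) = 0"
proof -
  note wi = square_integrable_integrable[OF square_integrable_vec_nth[OF square_integrable_w[OF t]]]
  note yi = square_integrable_integrable[OF square_integrable_vec_nth[OF y(2)]]
  have ym: "(\<lambda>\<omega>. y \<omega> $ i) \<in> borel_measurable (F t)" for i
    using y(1) by measurable
  have gm: "(\<lambda>v::real^'m. v $ i) \<in> borel_measurable borel" for i
    by measurable
  have "integrable M (\<lambda>\<omega>. y \<omega> $ i * w t \<omega> $ i)" for i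
    by (rule integrable_past_times_noise[OF t ym yi gm wi])
  moreover have "(\<integral>\<omega>. y \<omega> $ i * w t \<omega> $ i \<partial>M) = 0" for i
    using expectation_past_times_noise[OF t ym yi gm wi] w_mean_component[OF t] by simp
  ultimately show "integrable M (\<lambda>\<omega>. y \<omega> \<bullet> w t \<omega>)" "(\<integral>\<omega>. y \<omega> \<bullet> w t \<omega> \<partial>M) = 0"
    by (simp_all add: inner_vec_def Bochner_Integration.integral_sum)
qed

lemma
  fixes a :: "'a \<Rightarrow> real" and S :: "real^'m^'m"
  assumes t: "1 \<le> t" and a: "a \<in> borel_measurable (F t)" "integrable M a"
  shows integrable_past_times_noise_form: "integrable M (\<lambda>\<omega>. a \<omega> * (w t \<omega> \<bullet> (S *v w t \<omega>)))"
    and expectation_past_times_noise_form: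
      "(\<integral>\<omega>. a \<omega> * (w t \<omega> \<bullet> (S *v w t \<omega>)) \<partial>M) = (\<integral>\<omega>. a \<omega> \<partial>M) * trace (S ** \<Sigma>w)"
proof -
  note wn = square_integrable_vec_nth[OF square_integrable_w[OF t]]
  \<comment> \<open>The factors are ordered so that their moments are
    \<open>\<Sigma>w $ j $ i\<close>, which is how they occur in the trace of
    \<open>S ** \<Sigma>w\<close>.\<close>
  have form: "w t \<omega> \<bullet> (S *v w t \<omega>) = (\<Sum>i\<in>UNIV. \<Sum>j\<in>UNIV. S $ i $ j * (w t \<omega> $ j * w t \<omega> $ i))" for \<omega>
    by (simp add: inner_vec_def matrix_vector_mult_def sum_distrib_left algebra_simps)
  have ij: "integrable M (\<lambda>\<omega>. w t \<omega> $ j * w t \<omega> $ i)" for i j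
    using square_integrable_inner[OF wn wn] by simp
  have int: "integrable M (\<lambda>\<omega>. w t \<omega> \<bullet> (S *v w t \<omega>))"
    unfolding form using ij by (intro Bochner_Integration.integrable_sum integrable_mult_right)
  have gm: "(\<lambda>v. v \<bullet> (S *v v)) \<in> borel_measurable borel"
    by measurable
  show "integrable M (\<lambda>\<omega>. a \<omega> * (w t \<omega> \<bullet> (S *v w t \<omega>)))"
    by (rule integrable_past_times_noise[OF t a gm int])
  have "(\<integral>\<omega>. w t \<omega> \<bullet> (S *v w t \<omega>) \<partial>M) = trace (S ** \<Sigma>w)"
    unfolding form using ij
    by (simp add: Bochner_Integration.integral_sum w_second_moment[OF t] trace_def matrix_matrix_mult_def)
  then show "(\<integral>\<omega>. a \<omega> * (w t \<omega> \<bullet> (S *v w t \<omega>)) \<partial>M) = (\<integral>\<omega>. a \<omega> \<partial>M) * trace (S ** \<Sigma>w)"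
    using expectation_past_times_noise[OF t a gm int] by simp
qed

text \<open>This weight turns sums over the random range that begins at
  \<open>T - N \<omega> + 1\<close> into sums over \<open>{1..<T}\<close>, which commute with
  expectation. It depends on \<open>N\<close> alone and is therefore known at every time.\<close>

definition active :: "nat \<Rightarrow> 'a \<Rightarrow> real" where
  "active t \<omega> = of_bool (T - N \<omega> < t)"

lemma active_measurable [measurable]: "active t \<in> borel_measurable M"
  unfolding active_def by measurable

lemma active_information [measurable]: "active t \<in> borel_measurable (F s)"
  unfolding active_def by measurable

lemma integrable_active_times:
  fixes f :: "'a \<Rightarrow> real"
  assumes "integrable M f"
  shows "integrable M (\<lambda>\<omega>. active t \<omega> * f \<omega>)"
proof (rule Bochner_Integration.integrable_bound[OF assms])
  show "(\<lambda>\<omega>. active t \<omega> * f \<omega>) \<in> borel_measurable M"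
    using assms by measurable
qed (simp add: active_def)

lemma integrable_active: "integrable M (active t)"
  using integrable_active_times[of "\<lambda>_. 1" t] by simp

text \<open>For \<open>t = 0\<close> the first branch is never taken, so the initial time needs no
  separate treatment in recursions over \<open>t\<close>.\<close>

definition next_state :: "nat \<Rightarrow> ('a \<Rightarrow> real^'n) \<Rightarrow> ('a \<Rightarrow> real^'m) \<Rightarrow> 'a \<Rightarrow> real^'n" where
  "next_state t X U \<omega> =
     (if T - N \<omega> < t then A *v X \<omega> + B *v (U \<omega> + w t \<omega>)
      else if t = T - N \<omega> then xbar \<omega> else 0)"

lemma next_state_0: "next_state 0 X U = (\<lambda>\<omega>. if T \<le> N \<omega> then xbar \<omega> else 0)"
  by (auto simp: next_state_def fun_eq_iff)

definition past_L2 :: "nat \<Rightarrow> ('a \<Rightarrow> 'b::euclidean_space) \<Rightarrow> bool" where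
  "past_L2 t f \<longleftrightarrow> f \<in> borel_measurable (F t) \<and> square_integrable M f"

lemma next_state_information:
  assumes "X \<in> borel_measurable (F t)" "U \<in> borel_measurable (F t)" "1 \<le> t"
  shows "next_state t X U \<in> borel_measurable (F (t + 1))"
proof -
  have [measurable]: "X \<in> borel_measurable (F (t + 1))" "U \<in> borel_measurable (F (t + 1))"
    "w t \<in> borel_measurable (F (t + 1))"
    using assms measurable_from_subalg[OF information_mono[of t "t + 1"]] w_information by auto
  show ?thesis unfolding next_state_def by measurable
qed

lemma square_integrable_next_state:
  assumes X: "square_integrable M X" and U: "square_integrable M U" and t: "1 \<le> t"
  shows "square_integrable M (next_state t X U)"
proof -
  have [measurable]: "X \<in> borel_measurable M" "U \<in> borel_measurable M" "w t \<in> borel_measurable M"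
    using assms w_measurable by (auto simp: square_integrable_def)
  let ?Y = "\<lambda>\<omega>. A *v X \<omega> + B *v (U \<omega> + w t \<omega>)"
  have Y: "square_integrable M ?Y"
    by (intro square_integrable_add square_integrable_matrix_vector_mult X U square_integrable_w t)
  have "square_integrable M (\<lambda>\<omega>. if T - N \<omega> < t then ?Y \<omega> else 0)"
    by (rule square_integrable_bound[OF Y, of _ 1]) auto
  moreover have "square_integrable M (\<lambda>\<omega>. if t = T - N \<omega> then xbar \<omega> else 0)"
    by (rule square_integrable_bound[OF square_integrable_xbar, of _ 1]) auto
  moreover have "next_state t X U = (\<lambda>\<omega>. (if T - N \<omega> < t then ?Y \<omega> else 0) + (if t = T - N \<omega> then xbar \<omega> else 0))"
    by (auto simp: next_state_def fun_eq_iff)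
  ultimately show ?thesis using square_integrable_add by fastforce
qed

lemma past_L2_next_state:
  "past_L2 t X \<Longrightarrow> past_L2 t U \<Longrightarrow> 1 \<le> t \<Longrightarrow> past_L2 (t + 1) (next_state t X U)"
  using next_state_information[of X t U] square_integrable_next_state[of X U t]
  unfolding past_L2_def by blast

lemma past_L2_next_state_0: "past_L2 1 (next_state 0 X U)"
  unfolding past_L2_def next_state_0
proof
  show "(\<lambda>\<omega>. if T \<le> N \<omega> then xbar \<omega> else 0) \<in> borel_measurable (F 1)"
    by measurable
  show "square_integrable M (\<lambda>\<omega>. if T \<le> N \<omega> then xbar \<omega> else 0)"
    by (rule square_integrable_bound[OF square_integrable_xbar, of _ 1]) auto
qed

text \<open>\<open>forward_feasible\<close> demands no moments; here finite second moments are part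
  of the notion. The recursion includes \<open>t = 0\<close>, so it also fixes the first
  state.\<close>

definition admissible :: "(nat \<Rightarrow> 'a \<Rightarrow> real^'n) \<Rightarrow> (nat \<Rightarrow> 'a \<Rightarrow> real^'m) \<Rightarrow> bool" where
  "admissible x u \<longleftrightarrow>
     (\<forall>t\<in>{1..T}. past_L2 t (x t)) \<and> (\<forall>t\<in>{1..<T}. past_L2 t (u t)) \<and>
     (\<forall>t<T. \<forall>\<omega>\<in>space M. x (t + 1) \<omega> = next_state t (x t) (u t) \<omega>)"

lemma forward_feasible_next_state:
  assumes "forward_feasible A B T M xbar N w x u" "t < T" "\<omega> \<in> space M"
  shows "x (t + 1) \<omega> = next_state t (x t) (u t) \<omega>"
  using assms by (auto simp: forward_feasible_def next_state_def)

text \<open>The bound on \<open>u t\<close> may rely on the one for \<open>x t\<close>, which is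
  what a state feedback needs; states and controls are bounded together along the recursion.\<close>

lemma admissibleI:
  assumes eq: "\<And>t \<omega>. t < T \<Longrightarrow> \<omega> \<in> space M \<Longrightarrow> x (t + 1) \<omega> = next_state t (x t) (u t) \<omega>"
    and u: "\<And>t. t \<in> {1..<T} \<Longrightarrow> past_L2 t (x t) \<Longrightarrow> past_L2 t (u t)"
  shows "admissible x u"
proof -
  \<comment> \<open>The dynamics hold only on \<open>space M\<close>, so properties are transferred
    between functions that agree there.\<close>
  have cong: "past_L2 s f" if "past_L2 s g" "\<And>\<omega>. \<omega> \<in> space M \<Longrightarrow> f \<omega> = g \<omega>" for s and f g :: "'a \<Rightarrow> real^'n"
    using that measurable_cong[of "F s" f g borel] measurable_cong[of M f g borel]
      Bochner_Integration.integrable_cong[of M M "\<lambda>\<omega>. (norm (f \<omega>))\<^sup>2" "\<lambda>\<omega>. (norm (g \<omega>))\<^sup>2"]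
    unfolding past_L2_def square_integrable_def by simp
  have x: "t < T \<Longrightarrow> past_L2 (t + 1) (x (t + 1))" for t
  proof (induction t)
    case 0
    then show ?case
      using cong[OF past_L2_next_state_0] eq[of 0] by simp
  next
    case (Suc t)
    then have "past_L2 (Suc t) (x (Suc t))" "past_L2 (Suc t) (u (Suc t))"
      using u[of "Suc t"] by auto
    from cong[OF past_L2_next_state[OF this]] eq[OF Suc.prems] show ?case by simp
  qed
  have "past_L2 t (x t)" if "t \<in> {1..T}" for t
    using x[of "t - 1"] that by auto
  then show ?thesis
    using u eq unfolding admissible_def by auto
qed

text \<open>Feasibility requires causality of the controls only; the states inherit it. This yields
  measurability of the cost before any moment is known to be finite.\<close>

lemma forward_feasible_state_information:
  assumes f: "forward_feasible A B T M xbar N w x u" and t: "t \<in> {1..T}"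
  shows "x t \<in> borel_measurable (F t)"
proof -
  have "t < T \<Longrightarrow> x (t + 1) \<in> borel_measurable (F (t + 1))" for t
  proof (induction t)
    case 0
    have "next_state 0 (x 0) (u 0) \<in> borel_measurable (F 1)"
      using past_L2_next_state_0 unfolding past_L2_def by blast
    then show ?case
      using forward_feasible_next_state[OF f, of 0] 0
        measurable_cong[of "F 1" "x 1" "next_state 0 (x 0) (u 0)" borel] by simp
  next
    case (Suc t)
    then have "x (Suc t) \<in> borel_measurable (F (Suc t))" "u (Suc t) \<in> borel_measurable (F (Suc t))"
      using f by (auto simp: forward_feasible_def)
    from next_state_information[OF this]
    show ?case
      using forward_feasible_next_state[OF f Suc.prems]
        measurable_cong[of "F (Suc t + 1)" "x (Suc t + 1)" "next_state (Suc t) (x (Suc t)) (u (Suc t))" borel]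
      by simp
  qed
  from this[of "t - 1"] show ?thesis using t by auto
qed

text \<open>Expand the value at \<open>y + B w\<close> around \<open>y\<close>. The linear term is
  the noise times a vector known at time \<open>t\<close> and has mean zero; the quadratic term has
  the trace as its mean. This is the origin of the trace correction in the objective.\<close>

lemma
  fixes y :: "'a \<Rightarrow> real^'n"
  assumes t: "1 \<le> t" and y: "past_L2 t y" and P: "transpose P = P"
  shows integrable_noise_increment:
      "integrable M (\<lambda>\<omega>. active t \<omega> * (quadratic_value P \<eta> (y \<omega> + B *v w t \<omega>)
          - quadratic_value P \<eta> (y \<omega>) - 1/2 * trace (transpose B ** P ** B ** \<Sigma>w)))" (is "integrable M ?f")
    and expectation_noise_increment:
      "(\<integral>\<omega>. active t \<omega> * (quadratic_value P \<eta> (y \<omega> + B *v w t \<omega>)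
          - quadratic_value P \<eta> (y \<omega>) - 1/2 * trace (transpose B ** P ** B ** \<Sigma>w)) \<partial>M) = 0"
proof -
  let ?S = "transpose B ** P ** B"
  \<comment> \<open>The gradient of the value at \<open>y\<close>, pulled back through
    \<open>B\<close> and switched off before the start time.\<close>
  define z where "z \<omega> = active t \<omega> *\<^sub>R (transpose B *v (P *v y \<omega> + \<eta>))" for \<omega>
  have y': "y \<in> borel_measurable (F t)" "square_integrable M y"
    using y by (auto simp: past_L2_def)
  have z: "z \<in> borel_measurable (F t)" "square_integrable M z"
  proof -
    have L2: "square_integrable M (\<lambda>\<omega>. transpose B *v (P *v y \<omega> + \<eta>))"
      by (intro square_integrable_matrix_vector_mult square_integrable_add square_integrable_const y')
    show "z \<in> borel_measurable (F t)"
      unfolding z_def using y'(1) by (simp del: transpose_matrix_vector) measurable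
    show "square_integrable M z"
      unfolding z_def
    proof (rule square_integrable_bound[OF L2, of _ 1])
      show "(\<lambda>\<omega>. active t \<omega> *\<^sub>R (transpose B *v (P *v y \<omega> + \<eta>))) \<in> borel_measurable M"
        using square_integrable_measurable[OF L2] by measurable
    qed (simp add: active_def)
  qed
  note zw = integrable_past_inner_noise[OF t z] expectation_past_inner_noise[OF t z]
  note ww = integrable_past_times_noise_form[OF t active_information integrable_active, where S = ?S]
    expectation_past_times_noise_form[OF t active_information integrable_active, where S = ?S]
  have f: "?f = (\<lambda>\<omega>. z \<omega> \<bullet> w t \<omega> + (1/2 * (active t \<omega> * (w t \<omega> \<bullet> (?S *v w t \<omega>)))
      - 1/2 * trace (?S ** \<Sigma>w) * active t \<omega>))"
  proof
    fix \<omega>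
    show "?f \<omega> = z \<omega> \<bullet> w t \<omega> + (1/2 * (active t \<omega> * (w t \<omega> \<bullet> (?S *v w t \<omega>)))
      - 1/2 * trace (?S ** \<Sigma>w) * active t \<omega>)"
      using inner_symmetric_matrix[OF P, of "B *v w t \<omega>" "y \<omega>"]
      by (simp add: z_def quadratic_value_def algebra_simps inner_simps dot_lmul_matrix
          inner_vector_matrix matrix_vector_mul_assoc[symmetric]
          inner_commute[of "P *v y \<omega>"])
  qed
  show "integrable M ?f"
    unfolding f using zw(1) ww(1) integrable_active by simp
  show "integral\<^sup>L M ?f = 0"
    unfolding f using zw ww integrable_active by simp
qed

definition stage_gap :: "'n ioc_vars \<Rightarrow> (nat \<Rightarrow> 'a \<Rightarrow> real^'n) \<Rightarrow> (nat \<Rightarrow> 'a \<Rightarrow> real^'m) \<Rightarrow> nat \<Rightarrow> 'a \<Rightarrow> real" where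
  "stage_gap \<theta> x u t \<omega> = active t \<omega> *
     (block_vec3 (u t \<omega>) (x t \<omega>) 1 \<bullet> (lmi_matrix A B \<theta> t *v block_vec3 (u t \<omega>) (x t \<omega>) 1))"

text \<open>The stage summand of the objective with the control energy added. The boundary terms of
  the objective are spread over the stages as value differences, which telescope.\<close>

definition stage_value :: "'n ioc_vars \<Rightarrow> (nat \<Rightarrow> 'a \<Rightarrow> real^'n) \<Rightarrow> (nat \<Rightarrow> 'a \<Rightarrow> real^'m) \<Rightarrow> nat \<Rightarrow> 'a \<Rightarrow> real" where
  "stage_value = (\<lambda>(Q, q, P, \<eta>, \<xi>) x u t \<omega>.
     quadratic_value (P (t + 1)) (\<eta> (t + 1)) (x (t + 1) \<omega>) - quadratic_value (P t) (\<eta> t) (x t \<omega>)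
     + 1/2 * (norm (u t \<omega>))\<^sup>2 + 1/2 * (x t \<omega> \<bullet> (Q *v x t \<omega>)) + q t \<bullet> x t \<omega> + 1/2 * \<xi> t
     - 1/2 * trace (transpose B ** P (t + 1) ** B ** \<Sigma>w))"

lemma integrable_stage_gap:
  assumes adm: "admissible x u" and t: "t \<in> {1..<T}" and P: "transpose (P (t + 1)) = P (t + 1)"
  shows "integrable M (stage_gap (Q, q, P, \<eta>, \<xi>) x u t)"
proof -
  have x: "square_integrable M (x t)" and u: "square_integrable M (u t)"
    using adm t by (auto simp: admissible_def past_L2_def)
  show ?thesis
    unfolding stage_gap_def lmi_quadratic_form[of P t, OF P] power2_norm_eq_inner
    by (intro integrable_active_times integrable_mult_right Bochner_Integration.integrable_add
        Bochner_Integration.integrable_diff integrable_quadratic_value square_integrable_add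
        square_integrable_matrix_vector_mult square_integrable_inner square_integrable_const x u)
       simp
qed

text \<open>Splitting off the noise-free successor \<open>y\<close> of the state leaves half the
  stage gap plus the noise increment, whose mean is zero.\<close>

lemma
  assumes adm: "admissible x u" and t: "t \<in> {1..<T}" and P: "transpose (P (t + 1)) = P (t + 1)"
  shows integrable_stage_value: "integrable M (\<lambda>\<omega>. active t \<omega> * stage_value (Q, q, P, \<eta>, \<xi>) x u t \<omega>)"
    and expectation_stage_value: "(\<integral>\<omega>. active t \<omega> * stage_value (Q, q, P, \<eta>, \<xi>) x u t \<omega> \<partial>M)
      = 1/2 * (\<integral>\<omega>. stage_gap (Q, q, P, \<eta>, \<xi>) x u t \<omega> \<partial>M)"
proof -
  let ?\<theta> = "(Q, q, P, \<eta>, \<xi>)"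
  define y where "y \<omega> = A *v x t \<omega> + B *v u t \<omega>" for \<omega>
  define f where "f \<omega> = active t \<omega> * (quadratic_value (P (t + 1)) (\<eta> (t + 1)) (y \<omega> + B *v w t \<omega>)
          - quadratic_value (P (t + 1)) (\<eta> (t + 1)) (y \<omega>)
          - 1/2 * trace (transpose B ** P (t + 1) ** B ** \<Sigma>w))" for \<omega>
  have x: "past_L2 t (x t)" and u: "past_L2 t (u t)"
    using adm t by (auto simp: admissible_def)
  have y: "past_L2 t y"
    unfolding past_L2_def y_def
  proof
    have [measurable]: "x t \<in> borel_measurable (F t)" "u t \<in> borel_measurable (F t)"
      using x u by (auto simp: past_L2_def)
    show "(\<lambda>\<omega>. A *v x t \<omega> + B *v u t \<omega>) \<in> borel_measurable (F t)" by measurable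
    show "square_integrable M (\<lambda>\<omega>. A *v x t \<omega> + B *v u t \<omega>)"
      using x u unfolding past_L2_def
      by (intro square_integrable_add square_integrable_matrix_vector_mult) auto
  qed
  have t1: "1 \<le> t" using t by simp
  have f: "integrable M f" "integral\<^sup>L M f = 0"
    unfolding f_def
    by (rule integrable_noise_increment[OF t1 y P], rule expectation_noise_increment[OF t1 y P])
  note gap = integrable_stage_gap[where P = P and t = t, OF adm t P, of Q q \<eta> \<xi>]
  have eq: "active t \<omega> * stage_value ?\<theta> x u t \<omega> = 1/2 * stage_gap ?\<theta> x u t \<omega> + f \<omega>"
    if "\<omega> \<in> space M" for \<omega>
  proof (cases "T - N \<omega> < t")
    case True
    then have "x (t + 1) \<omega> = y \<omega> + B *v w t \<omega>"
      using adm t that by (simp add: admissible_def next_state_def y_def matrix_vector_right_distrib)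
    then show ?thesis
      unfolding stage_gap_def lmi_quadratic_form[of P t, OF P] f_def stage_value_def y_def
      by (simp add: algebra_simps)
  next
    case False
    then show ?thesis by (simp add: stage_gap_def f_def active_def)
  qed
  have "integrable M (\<lambda>\<omega>. 1/2 * stage_gap ?\<theta> x u t \<omega> + f \<omega>)"
    using gap f(1) by simp
  then show "integrable M (\<lambda>\<omega>. active t \<omega> * stage_value ?\<theta> x u t \<omega>)"
    by (simp add: eq cong: Bochner_Integration.integrable_cong)
  show "(\<integral>\<omega>. active t \<omega> * stage_value ?\<theta> x u t \<omega> \<partial>M) = 1/2 * (\<integral>\<omega>. stage_gap ?\<theta> x u t \<omega> \<partial>M)"
    by (simp add: eq gap f cong: Bochner_Integration.integral_cong)
qed

section \<open>The objective as a sum of expected stage gaps\<close>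

lemma active_sum: "(\<Sum>t\<in>{T - N \<omega> + 1..<T}. g t) = (\<Sum>t\<in>{1..<T}. active t \<omega> * g t)"
  by (rule sum.mono_neutral_cong_left) (auto simp: active_def)

lemma active_telescope:
  assumes "1 \<le> N \<omega>"
  shows "(\<Sum>t\<in>{1..<T}. active t \<omega> * (V (t + 1) - V t)) = V T - V (T - N \<omega> + 1)"
  unfolding active_sum[symmetric]
  using sum_Suc_diff'[of "T - N \<omega> + 1" T V] assms T_pos by simp

lemma sum_stage_value:
  assumes "1 \<le> N \<omega>"
  shows "(\<Sum>t\<in>{1..<T}. active t \<omega> * stage_value (Q, q, P, \<eta>, \<xi>) x u t \<omega>) =
    quadratic_value (P T) (\<eta> T) (x T \<omega>)
    - quadratic_value (P (T - N \<omega> + 1)) (\<eta> (T - N \<omega> + 1)) (x (T - N \<omega> + 1) \<omega>)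
    + (\<Sum>t\<in>{1..<T}. active t \<omega> * (1/2 * (norm (u t \<omega>))\<^sup>2 + 1/2 * (x t \<omega> \<bullet> (Q *v x t \<omega>)) + q t \<bullet> x t \<omega>
        + 1/2 * \<xi> t - 1/2 * trace (transpose B ** P (t + 1) ** B ** \<Sigma>w)))"
  unfolding active_telescope[OF assms, of "\<lambda>t. quadratic_value (P t) (\<eta> t) (x t \<omega>)", symmetric]
    sum.distrib[symmetric]
  by (rule sum.cong) (simp_all add: stage_value_def algebra_simps)

text \<open>The outcome \<open>N \<omega> = 0\<close> has its own branch: the start index is then
  \<open>T + 1\<close>, where the state is \<open>xbar\<close>, and telescoping would fail. Off this
  null event the integrand is the sum of stage values without the control energy.\<close>

lemma ioc_integrand_eq:
  assumes ff: "forward_feasible A B T M xbar N w x u" and \<omega>: "\<omega> \<in> space M"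
  shows "(let s = T - N \<omega> + 1 in
        1/2 * (x T \<omega> \<bullet> (P T *v x T \<omega>)) + \<eta> T \<bullet> x T \<omega>
        - 1/2 * (x s \<omega> \<bullet> (P s *v x s \<omega>)) - \<eta> s \<bullet> x s \<omega>
        + (\<Sum>t\<in>{s..<T}.
             1/2 * \<xi> t + 1/2 * (x t \<omega> \<bullet> (Q *v x t \<omega>)) + q t \<bullet> x t \<omega>
             - 1/2 * trace (transpose B ** P (t + 1) ** B ** \<Sigma>w))) =
    (if N \<omega> = 0 then - quadratic_value (P (T + 1)) (\<eta> (T + 1)) (xbar \<omega>)
     else \<Sum>t\<in>{1..<T}. active t \<omega> * stage_value (Q, q, P, \<eta>, \<xi>) x u t \<omega>
       - 1/2 * (active t \<omega> * (norm (u t \<omega>))\<^sup>2))"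
proof (cases "N \<omega> = 0")
  case True
  have "x (T + 1) \<omega> = xbar \<omega>" "x T \<omega> = 0"
    using ff \<omega> True T_pos by (auto simp: forward_feasible_def dest!: bspec[of _ _ \<omega>])
  then show ?thesis using True by (simp add: Let_def quadratic_value_def)
next
  case False
  then show ?thesis
    unfolding Let_def active_sum sum_subtractf
    using sum_stage_value[of \<omega> Q q P \<eta> \<xi> x u]
    by (simp add: quadratic_value_def algebra_simps sum.distrib sum_subtractf sum_distrib_left)
qed

lemma ioc_objective_eq:
  assumes ff: "forward_feasible A B T M xbar N w x u" and adm: "admissible x u"
    and P: "\<And>t. t \<in> {1..<T} \<Longrightarrow> transpose (P (t + 1)) = P (t + 1)"
  shows "ioc_objective B T \<Sigma>w M N x (Q, q, P, \<eta>, \<xi>) =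
    1/2 * (\<Sum>t\<in>{1..<T}. \<integral>\<omega>. stage_gap (Q, q, P, \<eta>, \<xi>) x u t \<omega> \<partial>M)
    - 1/2 * (\<Sum>t\<in>{1..<T}. \<integral>\<omega>. active t \<omega> * (norm (u t \<omega>))\<^sup>2 \<partial>M)"
proof -
  let ?\<theta> = "(Q, q, P, \<eta>, \<xi>)"
  let ?c = "\<lambda>\<omega>. - quadratic_value (P (T + 1)) (\<eta> (T + 1)) (xbar \<omega>)"
  let ?S = "\<lambda>\<omega>. \<Sum>t\<in>{1..<T}. active t \<omega> * stage_value ?\<theta> x u t \<omega> - 1/2 * (active t \<omega> * (norm (u t \<omega>))\<^sup>2)"
  have s: "integrable M (\<lambda>\<omega>. active t \<omega> * stage_value ?\<theta> x u t \<omega>)" if "t \<in> {1..<T}" for t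
    by (rule integrable_stage_value[where P = P and t = t, OF adm that P[OF that]])
  have n: "integrable M (\<lambda>\<omega>. active t \<omega> * (norm (u t \<omega>))\<^sup>2)" if "t \<in> {1..<T}" for t
    using adm that by (intro integrable_active_times) (auto simp: admissible_def past_L2_def square_integrable_def)
  have S: "integrable M ?S"
    using s n by (intro Bochner_Integration.integrable_sum Bochner_Integration.integrable_diff integrable_mult_right)
  have c: "integrable M ?c"
    using integrable_quadratic_value[OF square_integrable_xbar] by simp
  have [measurable]: "?S \<in> borel_measurable M" "?c \<in> borel_measurable M"
    using S c by auto
  have "ioc_objective B T \<Sigma>w M N x ?\<theta> = (\<integral>\<omega>. (if N \<omega> = 0 then ?c \<omega> else ?S \<omega>) \<partial>M)"
    unfolding ioc_objective_def prod.case
    by (rule Bochner_Integration.integral_cong[OF refl ioc_integrand_eq[OF ff]])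
  also have "\<dots> = integral\<^sup>L M ?S"
  proof (rule integral_cong_AE)
    show "AE \<omega> in M. (if N \<omega> = 0 then ?c \<omega> else ?S \<omega>) = ?S \<omega>"
      using N_bounds by (rule AE_mp) (simp add: AE_I2)
  qed measurable
  also have "\<dots> = (\<Sum>t\<in>{1..<T}. (\<integral>\<omega>. active t \<omega> * stage_value ?\<theta> x u t \<omega> \<partial>M)
      - 1/2 * (\<integral>\<omega>. active t \<omega> * (norm (u t \<omega>))\<^sup>2 \<partial>M))"
  proof (subst Bochner_Integration.integral_sum)
    show "integrable M (\<lambda>\<omega>. active t \<omega> * stage_value ?\<theta> x u t \<omega> - 1/2 * (active t \<omega> * (norm (u t \<omega>))\<^sup>2))"
      if "t \<in> {1..<T}" for t
      using s[OF that] n[OF that] by simp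
  qed (rule sum.cong[OF refl], subst Bochner_Integration.integral_diff, use s n in simp_all)
  also have "\<dots> = (\<Sum>t\<in>{1..<T}. 1/2 * (\<integral>\<omega>. stage_gap ?\<theta> x u t \<omega> \<partial>M)
      - 1/2 * (\<integral>\<omega>. active t \<omega> * (norm (u t \<omega>))\<^sup>2 \<partial>M))"
  proof (rule sum.cong[OF refl])
    fix t assume t: "t \<in> {1..<T}"
    show "(\<integral>\<omega>. active t \<omega> * stage_value ?\<theta> x u t \<omega> \<partial>M) - 1/2 * (\<integral>\<omega>. active t \<omega> * (norm (u t \<omega>))\<^sup>2 \<partial>M)
      = 1/2 * (\<integral>\<omega>. stage_gap ?\<theta> x u t \<omega> \<partial>M) - 1/2 * (\<integral>\<omega>. active t \<omega> * (norm (u t \<omega>))\<^sup>2 \<partial>M)"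
      using expectation_stage_value[where P = P and t = t, OF adm t P[OF t], of Q q \<eta> \<xi>] by simp
  qed
  finally show ?thesis by (simp add: sum_subtractf sum_distrib_left)
qed

section \<open>The optimal control of the forward problem\<close>

lemma state_at_start:
  assumes "admissible x u" "\<omega> \<in> space M" "1 \<le> N \<omega>"
  shows "x (T - N \<omega> + 1) \<omega> = xbar \<omega>"
  using assms T_pos by (simp add: admissible_def next_state_def)

lemma forward_cost_eq:
  "forward_cost T xr Q N x u \<omega> = 1/2 * ((x T \<omega> - xr T) \<bullet> (Q *v (x T \<omega> - xr T)))
    + (\<Sum>t\<in>{1..<T}. active t \<omega> * (1/2 * ((x t \<omega> - xr t) \<bullet> (Q *v (x t \<omega> - xr t))) + 1/2 * (norm (u t \<omega>))\<^sup>2))"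
  unfolding forward_cost_def active_sum ..

lemma shifted_quadratic_form:
  fixes Q :: "real^'k^'k"
  assumes "transpose Q = Q"
  shows "1/2 * ((y - r) \<bullet> (Q *v (y - r))) = 1/2 * (y \<bullet> (Q *v y)) + (- (Q *v r)) \<bullet> y + 1/2 * (r \<bullet> (Q *v r))"
  using inner_symmetric_matrix[OF assms, of y r] inner_commute[of y "Q *v r"]
  by (simp add: algebra_simps inner_simps)

text \<open>The right-hand side involves the outcome only through \<open>xbar\<close> and
  \<open>N\<close>. Hence cost minus stage values is the same random variable for all admissible
  pairs, and comparing costs amounts to comparing stage values.\<close>

lemma forward_cost_stage_value:
  assumes adm: "admissible x u" and \<omega>: "\<omega> \<in> space M" "1 \<le> N \<omega>"
    and Q: "transpose Q = Q" and q: "\<And>t. t \<in> {1..T} \<Longrightarrow> q t = - (Q *v xr t)"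
    and PT: "P T = Q" and \<eta>T: "\<eta> T = q T"
  shows "forward_cost T xr Q N x u \<omega> - (\<Sum>t\<in>{1..<T}. active t \<omega> * stage_value (Q, q, P, \<eta>, \<xi>) x u t \<omega>)
    = quadratic_value (P (T - N \<omega> + 1)) (\<eta> (T - N \<omega> + 1)) (xbar \<omega>) + 1/2 * (xr T \<bullet> (Q *v xr T))
      + (\<Sum>t\<in>{1..<T}. active t \<omega> * (1/2 * (xr t \<bullet> (Q *v xr t)) - 1/2 * \<xi> t
          + 1/2 * trace (transpose B ** P (t + 1) ** B ** \<Sigma>w)))"
proof -
  have "(\<Sum>t\<in>{1..<T}. active t \<omega> * (1/2 * ((x t \<omega> - xr t) \<bullet> (Q *v (x t \<omega> - xr t))) + 1/2 * (norm (u t \<omega>))\<^sup>2))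
    = (\<Sum>t\<in>{1..<T}. active t \<omega> * (1/2 * (norm (u t \<omega>))\<^sup>2 + 1/2 * (x t \<omega> \<bullet> (Q *v x t \<omega>)) + q t \<bullet> x t \<omega>
        + 1/2 * \<xi> t - 1/2 * trace (transpose B ** P (t + 1) ** B ** \<Sigma>w)))
      + (\<Sum>t\<in>{1..<T}. active t \<omega> * (1/2 * (xr t \<bullet> (Q *v xr t)) - 1/2 * \<xi> t
          + 1/2 * trace (transpose B ** P (t + 1) ** B ** \<Sigma>w)))"
    unfolding sum.distrib[symmetric]
    by (rule sum.cong[OF refl], subst shifted_quadratic_form[OF Q]) (simp add: q algebra_simps)
  moreover have "1/2 * ((x T \<omega> - xr T) \<bullet> (Q *v (x T \<omega> - xr T)))
      = quadratic_value (P T) (\<eta> T) (x T \<omega>) + 1/2 * (xr T \<bullet> (Q *v xr T))"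
    using T_pos by (subst shifted_quadratic_form[OF Q]) (simp add: q PT \<eta>T quadratic_value_def)
  ultimately show ?thesis
    unfolding forward_cost_eq sum_stage_value[OF \<omega>(2)] state_at_start[OF adm \<omega>]
    by linarith
qed

lemma forward_cost_measurable:
  assumes "forward_feasible A B T M xbar N w x u"
  shows "forward_cost T xr Q N x u \<in> borel_measurable M"
proof -
  have u: "u t \<in> borel_measurable M" if "t \<in> {1..<T}" for t
    using assms that by (intro information_measurableD[of _ t]) (auto simp: forward_feasible_def)
  have x: "x t \<in> borel_measurable M" if "t \<in> {1..T}" for t
    using forward_feasible_state_information[OF assms that] information_measurableD by blast
  have [measurable]: "x T \<in> borel_measurable M"
    using x T_pos by simp
  have [measurable]: "(\<lambda>\<omega>. \<Sum>t\<in>{1..<T}. active t \<omega> * (1/2 * ((x t \<omega> - xr t) \<bullet> (Q *v (x t \<omega> - xr t))) + 1/2 * (norm (u t \<omega>))\<^sup>2))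
      \<in> borel_measurable M"
  proof (rule borel_measurable_sum)
    fix t assume "t \<in> {1..<T}"
    then have [measurable]: "x t \<in> borel_measurable M" "u t \<in> borel_measurable M"
      using x u by auto
    show "(\<lambda>\<omega>. active t \<omega> * (1/2 * ((x t \<omega> - xr t) \<bullet> (Q *v (x t \<omega> - xr t))) + 1/2 * (norm (u t \<omega>))\<^sup>2))
        \<in> borel_measurable M"
      by measurable
  qed
  show ?thesis
    unfolding forward_cost_eq[abs_def] by measurable
qed

lemma integrable_forward_cost:
  assumes adm: "admissible x u"
  shows "integrable M (forward_cost T xr Q N x u)"
proof -
  have x: "square_integrable M (\<lambda>\<omega>. x t \<omega> - xr t)" if "t \<in> {1..T}" for t
    using adm that square_integrable_add[of M "x t" "\<lambda>_. - xr t"] square_integrable_const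
    by (auto simp: admissible_def past_L2_def)
  have xQ: "integrable M (\<lambda>\<omega>. (x t \<omega> - xr t) \<bullet> (Q *v (x t \<omega> - xr t)))" if "t \<in> {1..T}" for t
    using x[OF that] by (intro square_integrable_inner square_integrable_matrix_vector_mult)
  have u: "integrable M (\<lambda>\<omega>. (norm (u t \<omega>))\<^sup>2)" if "t \<in> {1..<T}" for t
    using adm that by (auto simp: admissible_def past_L2_def square_integrable_def)
  show ?thesis
    unfolding forward_cost_eq[abs_def] using xQ u T_pos
    by (intro Bochner_Integration.integrable_add Bochner_Integration.integrable_sum
        integrable_active_times integrable_mult_right) auto
qed

lemma forward_cost_nonneg:
  assumes "psd Q"
  shows "0 \<le> forward_cost T xr Q N x u \<omega>"
  using assms unfolding forward_cost_def psd_def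
  by (intro add_nonneg_nonneg sum_nonneg mult_nonneg_nonneg) auto

text \<open>Every summand of the cost is nonnegative. The bound converts finite expected cost into
  square integrability of the control.\<close>

lemma control_norm_le_forward_cost:
  assumes Q: "psd Q" and ff: "forward_feasible A B T M xbar N w x u"
    and t: "t \<in> {1..<T}" and \<omega>: "\<omega> \<in> space M"
  shows "(norm (u t \<omega>))\<^sup>2 \<le> 2 * forward_cost T xr Q N x u \<omega>"
proof (cases "T - N \<omega> < t")
  case True
  let ?g = "\<lambda>t. 1/2 * ((x t \<omega> - xr t) \<bullet> (Q *v (x t \<omega> - xr t))) + 1/2 * (norm (u t \<omega>))\<^sup>2"
  have nn: "0 \<le> (x t \<omega> - xr t) \<bullet> (Q *v (x t \<omega> - xr t))" for t
    using Q by (simp add: psd_def)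
  have "?g t \<le> (\<Sum>t\<in>{T - N \<omega> + 1..<T}. ?g t)"
    using True t nn by (intro member_le_sum) auto
  then show ?thesis
    using nn[of t] nn[of T] by (simp add: forward_cost_def)
next
  case False
  then have "u t \<omega> = 0" using ff t \<omega> by (auto simp: forward_feasible_def)
  then show ?thesis using forward_cost_nonneg[OF Q] by simp
qed

lemma stage_gap_nonneg:
  assumes "psd (lmi_matrix A B \<theta> t)"
  shows "0 \<le> stage_gap \<theta> x u t \<omega>"
  using assms by (simp add: stage_gap_def psd_def active_def)

section \<open>The affine feedback as a competitor in the forward problem\<close>

definition affine_control :: "real^'n^'m \<Rightarrow> real^'m \<Rightarrow> nat \<Rightarrow> ('a \<Rightarrow> real^'n) \<Rightarrow> 'a \<Rightarrow> real^'m" where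
  "affine_control K k t X \<omega> = (if T - N \<omega> < t then - (K *v X \<omega> + k) else 0)"

text \<open>The value at index 0 is a dummy: \<open>next_state 0\<close> ignores its state and
  control arguments.\<close>

primrec closed_loop :: "(nat \<Rightarrow> real^'n^'m) \<Rightarrow> (nat \<Rightarrow> real^'m) \<Rightarrow> nat \<Rightarrow> 'a \<Rightarrow> real^'n" where
  "closed_loop K k 0 = (\<lambda>_. 0)"
| "closed_loop K k (Suc t) = next_state t (closed_loop K k t) (affine_control (K t) (k t) t (closed_loop K k t))"

abbreviation closed_loop_control :: "(nat \<Rightarrow> real^'n^'m) \<Rightarrow> (nat \<Rightarrow> real^'m) \<Rightarrow> nat \<Rightarrow> 'a \<Rightarrow> real^'m" where
  "closed_loop_control K k t \<equiv> affine_control (K t) (k t) t (closed_loop K k t)"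

lemma past_L2_affine_control:
  assumes "past_L2 t X"
  shows "past_L2 t (affine_control K k t X)"
proof -
  have [measurable]: "X \<in> borel_measurable (F t)" "X \<in> borel_measurable M"
    using assms by (auto simp: past_L2_def square_integrable_def)
  have L2: "square_integrable M (\<lambda>\<omega>. K *v X \<omega> + k)"
    using assms unfolding past_L2_def
    by (intro square_integrable_add square_integrable_matrix_vector_mult square_integrable_const) auto
  have "affine_control K k t X \<in> borel_measurable (F t)" "affine_control K k t X \<in> borel_measurable M"
    unfolding affine_control_def by measurable
  moreover have "norm (affine_control K k t X \<omega>) \<le> 1 * norm (K *v X \<omega> + k)" for \<omega>
    by (simp add: affine_control_def del: minus_add_distrib)
  ultimately show ?thesis
    unfolding past_L2_def by (blast intro: square_integrable_bound[OF L2])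
qed

lemma closed_loop_admissible: "admissible (closed_loop K k) (closed_loop_control K k)"
  by (rule admissibleI) (auto intro: past_L2_affine_control)

lemma closed_loop_feasible:
  "forward_feasible A B T M xbar N w (closed_loop K k) (closed_loop_control K k)"
  unfolding forward_feasible_def
proof (intro conjI ballI)
  fix t assume "t \<in> {1..<T}"
  then show "closed_loop_control K k t \<in> borel_measurable (F t)"
    using closed_loop_admissible[of K k] by (auto simp: admissible_def past_L2_def)
next
  fix \<omega> t assume "t \<in> {1..T - N \<omega>}"
  then show "closed_loop K k t \<omega> = 0" "closed_loop_control K k t \<omega> = 0"
    by (cases t; auto simp: next_state_def affine_control_def)+
qed (auto simp: next_state_def)

text \<open>Optimality is stated conditionally on \<open>(xbar, N)\<close>. Integrating the
  conditional cost yields a comparison of total costs in \<open>ennreal\<close>, where infinite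
  values are still allowed.\<close>

lemma nn_integral_forward_expected_cost:
  assumes "forward_feasible A B T M xbar N w x u"
  shows "(\<integral>\<^sup>+\<omega>. forward_expected_cost T xr Q M xbar N x u \<omega> \<partial>M)
    = (\<integral>\<^sup>+\<omega>. ennreal (forward_cost T xr Q N x u \<omega>) \<partial>M)"
proof -
  interpret initial: sigma_finite_subalgebra M "initial_sigma M xbar N"
    by (rule finite_measure_subalgebra_is_sigma_finite) (unfold_locales, rule subalgebra_initial)
  have [measurable]: "forward_cost T xr Q N x u \<in> borel_measurable M"
    by (rule forward_cost_measurable[OF assms])
  show ?thesis
    using initial.nn_cond_exp_intg[of "\<lambda>_. 1" "\<lambda>\<omega>. ennreal (forward_cost T xr Q N x u \<omega>)"]
    by (simp add: forward_expected_cost_def)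
qed

text \<open>Comparison with the feedback process gives first finite cost, hence admissibility, and
  then a nonpositive sum of expected stage gaps. Each gap is the nonnegative \<open>R t\<close>-form
  of \<open>u + K x + k\<close>, so all of them vanish almost surely, and positive definiteness of
  \<open>R t\<close> gives the feedback law.\<close>

lemma forward_optimal_control:
  assumes opt: "forward_optimal A B T xr Q M xbar N w x u" and Q: "psd Q"
    and q: "\<And>t. t \<in> {1..T} \<Longrightarrow> q t = - (Q *v xr t)"
    and ric: "riccati_iterations A B T Q q P \<eta>"
  shows "admissible x u"
    and "\<And>t. t \<in> {1..<T} \<Longrightarrow> AE \<omega> in M. T - N \<omega> < t \<longrightarrow>
      u t \<omega> = - (feedback_gain A B (P (t + 1)) *v x t \<omega> + feedback_offset B (P (t + 1)) (\<eta> (t + 1)))"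
proof -
  define K where "K t = feedback_gain A B (P (t + 1))" for t
  define k where "k t = feedback_offset B (P (t + 1)) (\<eta> (t + 1))" for t
  define R where "R t = transpose B ** P (t + 1) ** B + mat 1" for t
  define \<xi> where "\<xi> t = schur_corner B (P (t + 1)) (\<eta> (t + 1))" for t
  let ?\<theta> = "(Q, q, P, \<eta>, \<xi>)"
  let ?x = "closed_loop K k" and ?u = "closed_loop_control K k"
  have ff: "forward_feasible A B T M xbar N w x u"
    using opt by (simp add: forward_optimal_def)
  note ff' = closed_loop_feasible[of K k] and adm' = closed_loop_admissible[of K k]
  have psd: "psd (P (t + 1))" if "t \<in> {1..<T}" for t
    using riccati_iterations_psd[OF ric Q, of "t + 1"] that by simp
  have R: "pos_def (R t)" if "t \<in> {1..<T}" for t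
    unfolding R_def by (rule pos_def_gain_denominator[OF psd[OF that]])
  have gap: "stage_gap ?\<theta> x u t \<omega> = active t \<omega> *
      ((u t \<omega> + K t *v x t \<omega> + k t) \<bullet> (R t *v (u t \<omega> + K t *v x t \<omega> + k t)))"
    if t: "t \<in> {1..<T}" for t x u \<omega>
    unfolding stage_gap_def K_def k_def R_def
    by (subst lmi_matrix_riccati(1)[where P = P and t = t, OF psd[OF t]]) (use ric t in \<open>simp_all add: riccati_iterations_def \<xi>_def\<close>)
  \<comment> \<open>For the feedback the completed square is zero by construction at every outcome,
    or the weight \<open>active\<close> is.\<close>
  have gap': "stage_gap ?\<theta> ?x ?u t \<omega> = 0" if "t \<in> {1..<T}" for t \<omega>
    unfolding gap[OF that] by (simp add: active_def affine_control_def)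
  let ?C = "forward_cost T xr Q N x u" and ?C' = "forward_cost T xr Q N ?x ?u"
  have [measurable]: "?C \<in> borel_measurable M"
    by (rule forward_cost_measurable[OF ff])
  have C': "integrable M ?C'" by (rule integrable_forward_cost[OF adm'])
  have nnC': "(\<integral>\<^sup>+\<omega>. ennreal (?C' \<omega>) \<partial>M) = ennreal (integral\<^sup>L M ?C')"
    by (rule nn_integral_eq_integral[OF C' AE_I2[OF forward_cost_nonneg[OF Q]]])
  \<comment> \<open>The cost of the optimal pair is not yet known to be integrable, so the first
    comparison uses nonnegative integrals.\<close>
  have nn_le: "(\<integral>\<^sup>+\<omega>. ennreal (?C \<omega>) \<partial>M) \<le> (\<integral>\<^sup>+\<omega>. ennreal (?C' \<omega>) \<partial>M)"
    unfolding nn_integral_forward_expected_cost[OF ff, symmetric]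
      nn_integral_forward_expected_cost[OF ff', symmetric]
    using opt ff' by (intro nn_integral_mono_AE) (auto simp: forward_optimal_def)
  have C: "integrable M ?C"
  proof (rule integrableI_nonneg)
    show "(\<integral>\<^sup>+\<omega>. ennreal (?C \<omega>) \<partial>M) < \<infinity>"
      using nn_le nnC' by (simp add: le_less_trans)
  qed (auto intro: AE_I2 forward_cost_nonneg[OF Q])
  have "ennreal (integral\<^sup>L M ?C) \<le> ennreal (integral\<^sup>L M ?C')"
    using nn_le nnC' nn_integral_eq_integral[OF C AE_I2[OF forward_cost_nonneg[OF Q]]] by simp
  then have C_le: "integral\<^sup>L M ?C \<le> integral\<^sup>L M ?C'"
    by (subst (asm) ennreal_le_iff) (auto intro!: integral_nonneg_AE AE_I2 forward_cost_nonneg[OF Q])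
  show adm: "admissible x u"
  proof (rule admissibleI)
    show "x (t + 1) \<omega> = next_state t (x t) (u t) \<omega>" if "t < T" "\<omega> \<in> space M" for t \<omega>
      by (rule forward_feasible_next_state[OF ff that])
    fix t assume t: "t \<in> {1..<T}"
    then have ut: "u t \<in> borel_measurable (F t)" using ff by (auto simp: forward_feasible_def)
    then have [measurable]: "u t \<in> borel_measurable M" by (rule information_measurableD)
    have "integrable M (\<lambda>\<omega>. (norm (u t \<omega>))\<^sup>2)"
    proof (rule Bochner_Integration.integrable_bound)
      show "integrable M (\<lambda>\<omega>. 2 * ?C \<omega>)" using C by simp
      show "AE \<omega> in M. norm ((norm (u t \<omega>))\<^sup>2) \<le> norm (2 * ?C \<omega>)"
        using control_norm_le_forward_cost[OF Q ff t, of _ xr]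
        by (intro AE_I2) (simp add: abs_le_iff order_trans[OF _ abs_ge_self])
    qed measurable
    then show "past_L2 t (u t)" using ut by (simp add: past_L2_def square_integrable_def)
  qed
  have Psym: "transpose (P (t + 1)) = P (t + 1)" if "t \<in> {1..<T}" for t
    by (rule psd_symmetric[OF psd[OF that]])
  have PT: "P T = Q" "\<eta> T = q T" using ric by (simp_all add: riccati_iterations_def)
  note int = integrable_stage_value[where P = P and Q = Q and q = q and \<eta> = \<eta> and \<xi> = \<xi>, OF _ _ Psym]
    and exp = expectation_stage_value[where P = P and Q = Q and q = q and \<eta> = \<eta> and \<xi> = \<xi>, OF _ _ Psym]
  have intsum: "integrable M (\<lambda>\<omega>. \<Sum>t\<in>{1..<T}. active t \<omega> * stage_value ?\<theta> x u t \<omega>)"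
    "integrable M (\<lambda>\<omega>. \<Sum>t\<in>{1..<T}. active t \<omega> * stage_value ?\<theta> ?x ?u t \<omega>)"
    by (intro Bochner_Integration.integrable_sum int adm adm'; assumption)+
  \<comment> \<open>Both differences equal the same expression in \<open>xbar\<close> and
    \<open>N\<close>, so the inequality between costs passes to the stage values.\<close>
  have "(\<integral>\<omega>. ?C \<omega> - (\<Sum>t\<in>{1..<T}. active t \<omega> * stage_value ?\<theta> x u t \<omega>) \<partial>M)
    = (\<integral>\<omega>. ?C' \<omega> - (\<Sum>t\<in>{1..<T}. active t \<omega> * stage_value ?\<theta> ?x ?u t \<omega>) \<partial>M)"
  proof (rule integral_cong_AE)
    show "AE \<omega> in M. ?C \<omega> - (\<Sum>t\<in>{1..<T}. active t \<omega> * stage_value ?\<theta> x u t \<omega>)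
      = ?C' \<omega> - (\<Sum>t\<in>{1..<T}. active t \<omega> * stage_value ?\<theta> ?x ?u t \<omega>)"
      using N_bounds
    proof (rule AE_mp, intro AE_I2 impI)
      fix \<omega> assume \<omega>: "\<omega> \<in> space M" "1 \<le> N \<omega>"
      note eq = forward_cost_stage_value[where P = P and Q = Q and q = q and \<eta> = \<eta> and \<xi> = \<xi> and xr = xr,
          OF _ \<omega> psd_symmetric[OF Q] q PT]
      show "?C \<omega> - (\<Sum>t\<in>{1..<T}. active t \<omega> * stage_value ?\<theta> x u t \<omega>)
        = ?C' \<omega> - (\<Sum>t\<in>{1..<T}. active t \<omega> * stage_value ?\<theta> ?x ?u t \<omega>)"
        using eq[OF adm] eq[OF adm'] by (simp only: simp_thms)
    qed
  qed (use C C' intsum in auto)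
  then have "integral\<^sup>L M ?C - (\<Sum>t\<in>{1..<T}. \<integral>\<omega>. active t \<omega> * stage_value ?\<theta> x u t \<omega> \<partial>M)
    = integral\<^sup>L M ?C' - (\<Sum>t\<in>{1..<T}. \<integral>\<omega>. active t \<omega> * stage_value ?\<theta> ?x ?u t \<omega> \<partial>M)"
    using C C' intsum int[OF adm] int[OF adm'] by (simp add: Bochner_Integration.integral_sum)
  then have "(\<Sum>t\<in>{1..<T}. \<integral>\<omega>. active t \<omega> * stage_value ?\<theta> x u t \<omega> \<partial>M)
      \<le> (\<Sum>t\<in>{1..<T}. \<integral>\<omega>. active t \<omega> * stage_value ?\<theta> ?x ?u t \<omega> \<partial>M)"
    using C_le by linarith
  also have "\<dots> = 0"
    using exp[OF adm'] gap' by (intro sum.neutral ballI) simp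
  also have "(\<Sum>t\<in>{1..<T}. \<integral>\<omega>. active t \<omega> * stage_value ?\<theta> x u t \<omega> \<partial>M)
      = (\<Sum>t\<in>{1..<T}. 1/2 * (\<integral>\<omega>. stage_gap ?\<theta> x u t \<omega> \<partial>M))"
    using exp[OF adm] by (intro sum.cong[OF refl]) simp
  finally have sum_le: "(\<Sum>t\<in>{1..<T}. 1/2 * (\<integral>\<omega>. stage_gap ?\<theta> x u t \<omega> \<partial>M)) \<le> 0" .
  have nonneg: "0 \<le> stage_gap ?\<theta> x u t \<omega>" if t: "t \<in> {1..<T}" for t \<omega>
    unfolding gap[OF t] R_def gain_denominator_inner
    using psd[OF t] by (simp add: psd_def active_def)
  fix t assume t: "t \<in> {1..<T}"
  have "(\<integral>\<omega>. stage_gap ?\<theta> x u t \<omega> \<partial>M) = 0"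
  proof -
    let ?g = "\<lambda>t. 1/2 * (\<integral>\<omega>. stage_gap ?\<theta> x u t \<omega> \<partial>M)"
    have g: "0 \<le> ?g t" if "t \<in> {1..<T}" for t
      using nonneg[OF that] by simp
    have "sum ?g {1..<T} = 0"
      using sum_le sum_nonneg[of "{1..<T}" ?g, OF g] by (rule antisym)
    then have "?g t = 0"
      using sum_nonneg_eq_0_iff[of "{1..<T}" ?g] g t by blast
    then show ?thesis by simp
  qed
  moreover have "integrable M (stage_gap ?\<theta> x u t)"
    by (rule integrable_stage_gap[where P = P and t = t, OF adm t Psym[OF t]])
  ultimately have "AE \<omega> in M. stage_gap ?\<theta> x u t \<omega> = 0"
    using integral_nonneg_eq_0_iff_AE nonneg[OF t] by blast
  then show "AE \<omega> in M. T - N \<omega> < t \<longrightarrow>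
      u t \<omega> = - (feedback_gain A B (P (t + 1)) *v x t \<omega> + feedback_offset B (P (t + 1)) (\<eta> (t + 1)))"
  proof (rule AE_mp, intro AE_I2 impI)
    fix \<omega> assume "stage_gap ?\<theta> x u t \<omega> = 0" "T - N \<omega> < t"
    then have "(u t \<omega> + K t *v x t \<omega> + k t) \<bullet> (R t *v (u t \<omega> + K t *v x t \<omega> + k t)) = 0"
      unfolding gap[OF t] by (simp add: active_def)
    then have "u t \<omega> + K t *v x t \<omega> + k t = 0"
      using R[OF t] unfolding pos_def_def by (metis less_irrefl)
    then show "u t \<omega> = - (feedback_gain A B (P (t + 1)) *v x t \<omega> + feedback_offset B (P (t + 1)) (\<eta> (t + 1)))"
      unfolding K_def k_def add.assoc by (rule eq_neg_iff_add_eq_0[THEN iffD2])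
  qed
qed

section \<open>Nondegeneracy of the state on the event of full horizon\<close>

definition full_horizon :: "'a \<Rightarrow> real" where
  "full_horizon \<omega> = of_bool (N \<omega> = T)"

lemma full_horizon_information [measurable]: "full_horizon \<in> borel_measurable (F t)"
  unfolding full_horizon_def by measurable

text \<open>Full horizon means start time 1, so the state there is \<open>xbar\<close>; the relation
  is then read under the conditional measure, where the covariance of \<open>xbar\<close> is
  positive definite.\<close>

lemma initial_state_nondegenerate:
  assumes adm: "admissible x u"
    and pos: "prob {\<omega> \<in> space M. N \<omega> = T} > 0"
    and cov: "pos_def (covariance_matrix (uniform_measure M {\<omega> \<in> space M. N \<omega> = T}) xbar xbar)"
    and AE: "AE \<omega> in M. N \<omega> = T \<longrightarrow> v \<bullet> x 1 \<omega> + c = 0"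
  shows "v = 0"
proof -
  let ?E = "{\<omega> \<in> space M. N \<omega> = T}"
  have E: "?E \<in> sets M" by measurable
  have Epos: "emeasure M ?E \<noteq> 0" "emeasure M ?E \<noteq> \<infinity>" "emeasure M ?E < \<infinity>"
    using pos by (simp_all add: emeasure_eq_measure)
  interpret U: prob_space "uniform_measure M ?E"
    by (rule prob_space_uniform_measure[OF Epos(1,2)])
  have "AE \<omega> in M. \<omega> \<in> ?E \<longrightarrow> v \<bullet> xbar \<omega> + c = 0"
    using AE
  proof (rule AE_mp, intro AE_I2 impI)
    fix \<omega> assume \<omega>: "\<omega> \<in> space M" "N \<omega> = T \<longrightarrow> v \<bullet> x 1 \<omega> + c = 0" "\<omega> \<in> ?E"
    then show "v \<bullet> xbar \<omega> + c = 0"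
      using state_at_start[OF adm \<omega>(1)] T_pos by simp
  qed
  then have "AE \<omega> in uniform_measure M ?E. v \<bullet> xbar \<omega> + c = 0"
    using Epos by (simp add: AE_uniform_measure)
  then show ?thesis
    by (rule U.covariance_pos_def_nondegenerate
        [OF square_integrable_uniform_measure[OF square_integrable_xbar E pos] cov])
qed

text \<open>Multiply the relation by \<open>r\<close> and integrate: independence and the zero mean of the noise
  leave only the expectation of \<open>r\<^sup>2\<close> on the event.\<close>

lemma noise_relation_past_part_vanishes:
  fixes b :: "real^'m" and r :: "'a \<Rightarrow> real"
  assumes t: "1 \<le> t" and r: "past_L2 t r"
    and AE: "AE \<omega> in M. N \<omega> = T \<longrightarrow> r \<omega> + b \<bullet> w t \<omega> = 0"
  shows "AE \<omega> in M. N \<omega> = T \<longrightarrow> r \<omega> = 0"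
proof -
  \<comment> \<open>Chosen so that on the event \<open>y \<bullet> w t\<close> is \<open>r\<close>
    times \<open>b \<bullet> w t\<close>, which the relation turns into minus the square of
    \<open>r\<close>.\<close>
  define y where "y \<omega> = (full_horizon \<omega> * r \<omega>) *\<^sub>R b" for \<omega>
  have [measurable]: "r \<in> borel_measurable (F t)" using r by (simp add: past_L2_def)
  have [measurable]: "r \<in> borel_measurable M" by (rule information_measurableD[of _ t]) measurable
  have [measurable]: "full_horizon \<in> borel_measurable M"
    by (rule information_measurableD[of _ t]) measurable
  have "square_integrable M y"
  proof (rule square_integrable_bound)
    show "square_integrable M r" using r by (simp add: past_L2_def)
    show "y \<in> borel_measurable M" unfolding y_def by measurable
    show "norm (y \<omega>) \<le> norm b * norm (r \<omega>)" for \<omega>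
      by (simp add: y_def full_horizon_def)
  qed
  moreover have "y \<in> borel_measurable (F t)" unfolding y_def by measurable
  ultimately have yw: "integrable M (\<lambda>\<omega>. y \<omega> \<bullet> w t \<omega>)" "(\<integral>\<omega>. y \<omega> \<bullet> w t \<omega> \<partial>M) = 0"
    using integrable_past_inner_noise[OF t] expectation_past_inner_noise[OF t] by auto
  have eq: "AE \<omega> in M. full_horizon \<omega> * (r \<omega>)\<^sup>2 = - (y \<omega> \<bullet> w t \<omega>)"
    using AE
  proof (rule AE_mp, intro AE_I2 impI)
    fix \<omega> assume *: "N \<omega> = T \<longrightarrow> r \<omega> + b \<bullet> w t \<omega> = 0"
    show "full_horizon \<omega> * (r \<omega>)\<^sup>2 = - (y \<omega> \<bullet> w t \<omega>)"
    proof (cases "N \<omega> = T")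
      case True
      then have "b \<bullet> w t \<omega> = - r \<omega>" using * by simp
      then show ?thesis using True by (simp add: y_def full_horizon_def power2_eq_square)
    qed (simp add: y_def full_horizon_def)
  qed
  have int: "integrable M (\<lambda>\<omega>. full_horizon \<omega> * (r \<omega>)\<^sup>2)"
    by (rule integrable_cong_AE_imp[of _ "\<lambda>\<omega>. - (y \<omega> \<bullet> w t \<omega>)"]) (use yw eq in auto)
  have "(\<integral>\<omega>. full_horizon \<omega> * (r \<omega>)\<^sup>2 \<partial>M) = (\<integral>\<omega>. - (y \<omega> \<bullet> w t \<omega>) \<partial>M)"
    using int yw eq by (intro integral_cong_AE) auto
  also have "\<dots> = 0" using yw by simp
  finally have "AE \<omega> in M. full_horizon \<omega> * (r \<omega>)\<^sup>2 = 0"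
    using integral_nonneg_eq_0_iff_AE[OF int] by (simp add: full_horizon_def)
  then show ?thesis by (rule AE_mp) (simp add: full_horizon_def AE_I2)
qed

lemma state_nondegenerate:
  assumes adm: "admissible x u"
    and pos: "prob {\<omega> \<in> space M. N \<omega> = T} > 0"
    and cov: "pos_def (covariance_matrix (uniform_measure M {\<omega> \<in> space M. N \<omega> = T}) xbar xbar)"
    and u: "\<And>t. t \<in> {1..<T} \<Longrightarrow> AE \<omega> in M. T - N \<omega> < t \<longrightarrow> u t \<omega> = - (K t *v x t \<omega> + k t)"
    and K: "\<And>t. t \<in> {1..<T} \<Longrightarrow> invertible (A - B ** K t)"
    and t: "1 \<le> t" "t \<le> T"
    and AE: "AE \<omega> in M. N \<omega> = T \<longrightarrow> v \<bullet> x t \<omega> + c = 0"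
  shows "v = 0"
  using t AE
proof (induction t arbitrary: v c rule: nat_induct_at_least)
  case base
  then show ?case using initial_state_nondegenerate[OF adm pos cov] by simp
next
  case (Suc t)
  then have t: "t \<in> {1..<T}" by simp
  \<comment> \<open>The normal and the constant obtained by inserting the feedback step into
    \<open>v \<bullet> x (Suc t) \<omega> + c\<close>.\<close>
  define a where "a = transpose (A - B ** K t) *v v"
  define d where "d = c - v \<bullet> (B *v k t)"
  have x: "past_L2 t (x t)" using adm t by (auto simp: admissible_def)
  have r: "past_L2 t (\<lambda>\<omega>. a \<bullet> x t \<omega> + d)"
    unfolding past_L2_def
  proof
    have [measurable]: "x t \<in> borel_measurable (F t)" using x by (simp add: past_L2_def)
    show "(\<lambda>\<omega>. a \<bullet> x t \<omega> + d) \<in> borel_measurable (F t)" by measurable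
    have "square_integrable M (\<lambda>\<omega>. a \<bullet> x t \<omega>)"
    proof (rule square_integrable_bound)
      show "square_integrable M (x t)" using x by (simp add: past_L2_def)
      then have [measurable]: "x t \<in> borel_measurable M" by (rule square_integrable_measurable)
      show "(\<lambda>\<omega>. a \<bullet> x t \<omega>) \<in> borel_measurable M" by measurable
      show "norm (a \<bullet> x t \<omega>) \<le> norm a * norm (x t \<omega>)" for \<omega>
        using Cauchy_Schwarz_ineq2 by simp
    qed
    then show "square_integrable M (\<lambda>\<omega>. a \<bullet> x t \<omega> + d)"
      by (intro square_integrable_add square_integrable_const)
  qed
  have "AE \<omega> in M. N \<omega> = T \<longrightarrow> (a \<bullet> x t \<omega> + d) + (transpose B *v v) \<bullet> w t \<omega> = 0"
    using Suc.prems(2) u[OF t] AE_space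
  proof eventually_elim
    case (elim \<omega>)
    show ?case
    proof
      assume N: "N \<omega> = T"
      have "x (Suc t) \<omega> = A *v x t \<omega> + B *v (- (K t *v x t \<omega> + k t) + w t \<omega>)"
        using adm t elim N by (simp add: admissible_def next_state_def)
      then have "v \<bullet> (A *v x t \<omega> + B *v (- (K t *v x t \<omega> + k t) + w t \<omega>)) + c = 0"
        using elim N by simp
      moreover have "B *v (- (K t *v x t \<omega> + k t) + w t \<omega>)
          = B *v w t \<omega> - B *v (K t *v x t \<omega>) - B *v k t"
        by (simp add: algebra_simps)
      ultimately show "(a \<bullet> x t \<omega> + d) + (transpose B *v v) \<bullet> w t \<omega> = 0"
        by (simp add: a_def d_def dot_lmul_matrix matrix_vector_mult_diff_rdistrib
            matrix_vector_mul_assoc[symmetric] inner_simps)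
    qed
  qed
  from noise_relation_past_part_vanishes[OF Suc.hyps r this]
  have "a = 0" using Suc.IH[of a d] t by simp
  moreover have "\<exists>Z. Z ** transpose (A - B ** K t) = mat 1"
    using transpose_invertible[OF K[OF t]] by (auto simp: invertible_def)
  ultimately show "v = 0"
    unfolding a_def by (metis matrix_left_invertible_ker)
qed

text \<open>Each row of \<open>G\<close> is the normal of an affine relation and hence zero; the
  relation then reads \<open>g = 0\<close> on an event of positive probability.\<close>

lemma affine_map_vanishes:
  fixes G :: "real^'n^'k" and X :: "'a \<Rightarrow> real^'n"
  assumes nondeg: "\<And>v c. (AE \<omega> in M. N \<omega> = T \<longrightarrow> v \<bullet> X \<omega> + c = 0) \<Longrightarrow> v = 0"
    and pos: "prob {\<omega> \<in> space M. N \<omega> = T} > 0"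
    and AE: "AE \<omega> in M. N \<omega> = T \<longrightarrow> G *v X \<omega> + g = 0"
  shows "G = 0" and "g = 0"
proof -
  have "G $ i = 0" for i
  proof (rule nondeg)
    show "AE \<omega> in M. N \<omega> = T \<longrightarrow> G $ i \<bullet> X \<omega> + g $ i = 0"
      using AE
    proof eventually_elim
      case (elim \<omega>)
      then show ?case
        by (metis matrix_vector_mul_component vector_add_component zero_index)
    qed
  qed
  then show G: "G = 0" by (simp add: vec_eq_iff)
  show "g = 0"
  proof (rule ccontr)
    assume "g \<noteq> 0"
    then have "AE \<omega> in M. N \<omega> \<noteq> T" using AE G by auto
    then have "prob {\<omega> \<in> space M. N \<omega> = T} = 0"
      by (subst prob_eq_0) auto
    then show False using pos by simp
  qed
qed

text \<open>A vanishing form of a semidefinite matrix puts the block vector into its kernel. With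
  the feedback law inserted, the first two block rows are affine in \<open>x t\<close> and vanish on
  the full-horizon event, so their coefficients can be read off as equations.\<close>

lemma zero_gap_stationarity:
  assumes lmi: "psd (lmi_matrix A B (Q, q, P, \<eta>, \<xi>) t)" and t: "t \<in> {1..<T}"
    and gap: "AE \<omega> in M. stage_gap (Q, q, P, \<eta>, \<xi>) x u t \<omega> = 0"
    and u: "AE \<omega> in M. T - N \<omega> < t \<longrightarrow> u t \<omega> = - (K *v x t \<omega> + k)"
    and nondeg: "\<And>v c. (AE \<omega> in M. N \<omega> = T \<longrightarrow> v \<bullet> x t \<omega> + c = 0) \<Longrightarrow> v = 0"
    and pos: "prob {\<omega> \<in> space M. N \<omega> = T} > 0"
  shows "(transpose B ** P (t + 1) ** B + mat 1) ** K = transpose B ** P (t + 1) ** A"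
    and "P t = transpose A ** P (t + 1) ** A + Q - transpose A ** P (t + 1) ** B ** K"
    and "\<eta> t = q t + transpose A *v \<eta> (t + 1) - transpose A ** P (t + 1) ** B *v k"
proof -
  define R where "R = transpose B ** P (t + 1) ** B + mat 1"
  define S where "S = transpose B ** P (t + 1) ** A"
  define S' where "S' = transpose A ** P (t + 1) ** B"
  define W where "W = transpose A ** P (t + 1) ** A + Q - P t"
  define g where "g = transpose B *v \<eta> (t + 1)"
  define \<beta> where "\<beta> = q t + transpose A *v \<eta> (t + 1) - \<eta> t"
  have L: "lmi_matrix A B (Q, q, P, \<eta>, \<xi>) t
      = block_matrix3 R S g S' W \<beta> (\<eta> (t + 1) v* B) \<beta> (\<xi> t)"
    by (simp add: lmi_matrix_def R_def S_def S'_def W_def g_def \<beta>_def Let_def)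
  have kernel: "AE \<omega> in M. N \<omega> = T \<longrightarrow>
      ((S - R ** K) *v x t \<omega> + (g - R *v k) = 0 \<and> (W - S' ** K) *v x t \<omega> + (\<beta> - S' *v k) = 0)"
    using gap u
  proof eventually_elim
    case (elim \<omega>)
    show ?case
    proof
      assume N: "N \<omega> = T"
      then have ut: "u t \<omega> = - (K *v x t \<omega> + k)" using elim t by simp
      have "lmi_matrix A B (Q, q, P, \<eta>, \<xi>) t *v block_vec3 (u t \<omega>) (x t \<omega>) 1 = 0"
        using elim N t by (intro psd_quadratic_form_eq_0[OF lmi]) (simp add: stage_gap_def active_def)
      then have "R *v u t \<omega> + S *v x t \<omega> + g = 0" "S' *v u t \<omega> + W *v x t \<omega> + \<beta> = 0"
        unfolding L block_matrix3_mult_block_vec3 block_vec3_zero block_vec3_inject by simp_all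
      moreover have "R *v u t \<omega> = - (R *v (K *v x t \<omega>) + R *v k)"
        "S' *v u t \<omega> = - (S' *v (K *v x t \<omega>) + S' *v k)"
        unfolding ut linear_neg[OF matrix_vector_mul_linear] matrix_vector_right_distrib by (rule refl)+
      ultimately show "(S - R ** K) *v x t \<omega> + (g - R *v k) = 0
          \<and> (W - S' ** K) *v x t \<omega> + (\<beta> - S' *v k) = 0"
        by (simp add: matrix_vector_mult_diff_rdistrib matrix_vector_mul_assoc[symmetric] algebra_simps)
    qed
  qed
  have AE1: "AE \<omega> in M. N \<omega> = T \<longrightarrow> (S - R ** K) *v x t \<omega> + (g - R *v k) = 0"
    using kernel by eventually_elim blast
  have "S - R ** K = 0"
    by (rule affine_map_vanishes(1)[OF _ pos AE1]) (erule nondeg)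
  then show "R ** K = S" by simp
  have AE2: "AE \<omega> in M. N \<omega> = T \<longrightarrow> (W - S' ** K) *v x t \<omega> + (\<beta> - S' *v k) = 0"
    using kernel by eventually_elim blast
  have "W - S' ** K = 0"
    by (rule affine_map_vanishes(1)[OF _ pos AE2]) (erule nondeg)
  moreover have "\<beta> - S' *v k = 0"
    by (rule affine_map_vanishes(2)[OF _ pos AE2]) (erule nondeg)
  ultimately show "P t = transpose A ** P (t + 1) ** A + Q - S' ** K"
    "\<eta> t = q t + transpose A *v \<eta> (t + 1) - S' *v k"
    by (simp_all add: W_def \<beta>_def algebra_simps)
qed

end

section \<open>Identifiability\<close>

theorem theorem1:
  fixes A :: "real^'n^'n" and B :: "real^'m^'n"
    and xr :: "nat \<Rightarrow> real^'n" and \<phi> :: real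
    and \<nu>1 \<nu>2 :: nat
    and \<Sigma>w :: "real^'m^'m"
    and M :: "'a measure"
    and xbar :: "'a \<Rightarrow> real^'n" and N :: "'a \<Rightarrow> nat"
    and w :: "nat \<Rightarrow> 'a \<Rightarrow> real^'m"
    and x :: "nat \<Rightarrow> 'a \<Rightarrow> real^'n" and u :: "nat \<Rightarrow> 'a \<Rightarrow> real^'m"
    and Qbar :: "real^'n^'n" and qbar :: "nat \<Rightarrow> real^'n"
    and Pbar :: "nat \<Rightarrow> real^'n^'n" and \<eta>bar :: "nat \<Rightarrow> real^'n"
  assumes "prob_space M"
    and "xbar \<in> borel_measurable M"
    and "N \<in> measurable M (count_space UNIV)"
    and "\<And>t. 1 \<le> t \<Longrightarrow> w t \<in> borel_measurable M"
    and "forward_optimal A B \<nu>2 xr Qbar M xbar N w x u"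
    and "\<And>t. t \<in> {1..\<nu>2} \<Longrightarrow> qbar t = - (Qbar *v xr t)"
    and "riccati_iterations A B \<nu>2 Qbar qbar Pbar \<eta>bar"
    and "1 \<le> \<nu>1" and "\<nu>1 \<le> \<nu>2" and "CARD('n) + 1 \<le> \<nu>2"
    and "AE \<omega> in M. N \<omega> \<in> {\<nu>1..\<nu>2}"
    and "measure M {\<omega> \<in> space M. N \<omega> = \<nu>2} > 0"
    and "controllable A B" and "rank B = CARD('m)" and "invertible A"
    and "independent_inputs M xbar N w"
    and "\<And>s t. 1 \<le> s \<Longrightarrow> 1 \<le> t \<Longrightarrow> distr M borel (w s) = distr M borel (w t)"
    and "\<And>t. 1 \<le> t \<Longrightarrow> integrable M (\<lambda>\<omega>. (norm (w t \<omega>))\<^sup>2)"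
    and "\<And>t. 1 \<le> t \<Longrightarrow> (\<integral>\<omega>. w t \<omega> \<partial>M) = 0"
    and "\<And>t. 1 \<le> t \<Longrightarrow> covariance_matrix M (w t) (w t) = \<Sigma>w"
    and "pos_def \<Sigma>w"
    and "pos_def (covariance_matrix (uniform_measure M {\<omega> \<in> space M. N \<omega> = \<nu>2}) xbar xbar)"
    and "integrable M (\<lambda>\<omega>. (norm (xbar \<omega>))\<^sup>2)"
    and "0 < \<phi>" and "Qbar \<in> bounded_psd \<phi>"
  shows "(\<exists>\<xi>. ioc_optimal A B \<nu>2 xr \<phi> \<Sigma>w M N x (Qbar, qbar, Pbar, \<eta>bar, \<xi>)) \<and>
         (\<forall>Q q P \<eta> \<xi>. ioc_optimal A B \<nu>2 xr \<phi> \<Sigma>w M N x (Q, q, P, \<eta>, \<xi>) \<longrightarrow>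
            Q = Qbar \<and>
            (\<forall>t\<in>{1..\<nu>2}. q t = qbar t \<and> P t = Pbar t \<and> \<eta> t = \<eta>bar t))"
proof -
  note opt = assms(5) and qbar = assms(6) and ric = assms(7)
  have N1: "AE \<omega> in M. 1 \<le> N \<omega>"
    using assms(11) by (rule AE_mp) (use assms(8) in \<open>auto intro: AE_I2\<close>)
  interpret random_horizon_control M A B \<nu>2 \<Sigma>w xbar N w
    using assms N1
    by (intro random_horizon_control.intro random_horizon_control_axioms.intro) auto
  have Qbar: "psd Qbar" "norm Qbar \<le> \<phi>" using assms(25) by (simp_all add: bounded_psd_def)
  have Pbar: "psd (Pbar t)" if "t \<in> {1..\<nu>2}" for t
    using riccati_iterations_psd[OF ric Qbar(1)] that by simp
  define K where "K t = feedback_gain A B (Pbar (t + 1))" for t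
  define k where "k t = feedback_offset B (Pbar (t + 1)) (\<eta>bar (t + 1))" for t
  define \<xi>bar where "\<xi>bar t = schur_corner B (Pbar (t + 1)) (\<eta>bar (t + 1))" for t
  let ?\<theta>bar = "(Qbar, qbar, Pbar, \<eta>bar, \<xi>bar)"
  have ff: "forward_feasible A B \<nu>2 M xbar N w x u" using opt by (simp add: forward_optimal_def)
  have adm: "admissible x u"
    by (rule forward_optimal_control(1)[OF opt Qbar(1) qbar ric])
  have u: "AE \<omega> in M. \<nu>2 - N \<omega> < t \<longrightarrow> u t \<omega> = - (K t *v x t \<omega> + k t)" if "t \<in> {1..<\<nu>2}" for t
    unfolding K_def k_def by (rule forward_optimal_control(2)[OF opt Qbar(1) qbar ric that])
  have invK: "invertible (A - B ** K t)" if t: "t \<in> {1..<\<nu>2}" for t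
  proof (rule invertible_closed_loop[OF assms(15)])
    have "psd (Pbar (t + 1))" using Pbar t by simp
    then show "K t = transpose B ** Pbar (t + 1) ** (A - B ** K t)"
      using gain_equation[of "Pbar (t + 1)" B A] gain_equation_closed_loop unfolding K_def by blast
  qed
  have nondeg: "v = 0"
    if "t \<in> {1..<\<nu>2}" "AE \<omega> in M. N \<omega> = \<nu>2 \<longrightarrow> v \<bullet> x t \<omega> + c = 0" for t v c
    using state_nondegenerate[OF adm assms(12) assms(22) u invK _ _ that(2)] that(1) by simp

  \<comment> \<open>Independent of the decision variables, so minimizing the objective means
    minimizing the expected gaps, and the least value is \<open>- energy\<close>.\<close>
  define energy where "energy = 1/2 * (\<Sum>t\<in>{1..<\<nu>2}. \<integral>\<omega>. active t \<omega> * (norm (u t \<omega>))\<^sup>2 \<partial>M)"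
  have objective: "ioc_objective B \<nu>2 \<Sigma>w M N x \<theta> =
      (\<Sum>t\<in>{1..<\<nu>2}. 1/2 * (\<integral>\<omega>. stage_gap \<theta> x u t \<omega> \<partial>M)) - energy"
    if "ioc_feasible A B \<nu>2 xr \<phi> \<theta>" for \<theta>
  proof -
    obtain Q q P \<eta> \<xi> where \<theta>: "\<theta> = (Q, q, P, \<eta>, \<xi>)" by (cases \<theta>) auto
    have "transpose (P (t + 1)) = P (t + 1)" if "t \<in> {1..<\<nu>2}" for t
      using \<open>ioc_feasible A B \<nu>2 xr \<phi> \<theta>\<close> that by (intro psd_symmetric) (auto simp: \<theta> ioc_feasible_def)
    then show ?thesis
      unfolding \<theta> energy_def sum_distrib_left[symmetric] by (rule ioc_objective_eq[OF ff adm])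
  qed
  have gap_nonneg: "0 \<le> stage_gap \<theta> x u t \<omega>"
    if "ioc_feasible A B \<nu>2 xr \<phi> \<theta>" "t \<in> {1..<\<nu>2}" for \<theta> t \<omega>
  proof (rule stage_gap_nonneg)
    show "psd (lmi_matrix A B \<theta> t)" using that by (cases \<theta>) (auto simp: ioc_feasible_def)
  qed
  have gap_integrable: "integrable M (stage_gap \<theta> x u t)"
    if "ioc_feasible A B \<nu>2 xr \<phi> \<theta>" and t: "t \<in> {1..<\<nu>2}" for \<theta> t
  proof -
    obtain Q q P \<eta> \<xi> where \<theta>: "\<theta> = (Q, q, P, \<eta>, \<xi>)" by (cases \<theta>) auto
    have "transpose (P (t + 1)) = P (t + 1)"
      using that by (intro psd_symmetric) (auto simp: \<theta> ioc_feasible_def)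
    then show ?thesis
      unfolding \<theta> using integrable_stage_gap[where P = P and t = t, OF adm t] by blast
  qed

  have bar_step: "Pbar t = transpose A ** Pbar (t + 1) ** A + Qbar
        - transpose A ** Pbar (t + 1) ** B ** feedback_gain A B (Pbar (t + 1))"
    "\<eta>bar t = transpose (A - B ** feedback_gain A B (Pbar (t + 1))) *v \<eta>bar (t + 1) + qbar t"
    if "t \<in> {1..<\<nu>2}" for t
    using ric that by (simp_all add: riccati_iterations_def)
  have psd_next: "psd (Pbar (t + 1))" if "t \<in> {1..<\<nu>2}" for t using Pbar that by simp
  note bar_lmi = lmi_matrix_riccati[where P = Pbar and \<eta> = \<eta>bar and Q = Qbar and q = qbar and \<xi> = \<xi>bar,
      OF psd_next bar_step \<xi>bar_def]
  have bar_feasible: "ioc_feasible A B \<nu>2 xr \<phi> ?\<theta>bar"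
    using Qbar Pbar qbar ric bar_lmi(2) by (simp add: ioc_feasible_def bounded_psd_def riccati_iterations_def)
  have bar_gap: "AE \<omega> in M. stage_gap ?\<theta>bar x u t \<omega> = 0" if t: "t \<in> {1..<\<nu>2}" for t
    using u[OF t]
  proof eventually_elim
    case (elim \<omega>)
    then show ?case
      unfolding stage_gap_def bar_lmi(1)[OF t t t] by (auto simp: active_def K_def k_def)
  qed
  have bar_objective: "ioc_objective B \<nu>2 \<Sigma>w M N x ?\<theta>bar = - energy"
  proof -
    have "(\<integral>\<omega>. stage_gap ?\<theta>bar x u t \<omega> \<partial>M) = 0" if "t \<in> {1..<\<nu>2}" for t
      using integral_eq_zero_AE[OF bar_gap[OF that]] .
    then show ?thesis unfolding objective[OF bar_feasible] by simp
  qed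
  have bar_optimal: "ioc_optimal A B \<nu>2 xr \<phi> \<Sigma>w M N x ?\<theta>bar"
    unfolding ioc_optimal_def is_arg_min_def
  proof (intro conjI notI)
    show "ioc_feasible A B \<nu>2 xr \<phi> ?\<theta>bar" by (rule bar_feasible)
    assume "\<exists>\<theta>. ioc_feasible A B \<nu>2 xr \<phi> \<theta>
      \<and> ioc_objective B \<nu>2 \<Sigma>w M N x \<theta> < ioc_objective B \<nu>2 \<Sigma>w M N x ?\<theta>bar"
    then obtain \<theta> where feas: "ioc_feasible A B \<nu>2 xr \<phi> \<theta>"
      and less: "ioc_objective B \<nu>2 \<Sigma>w M N x \<theta> < - energy"
      unfolding bar_objective by blast
    have "0 \<le> (\<Sum>t\<in>{1..<\<nu>2}. 1/2 * (\<integral>\<omega>. stage_gap \<theta> x u t \<omega> \<partial>M))"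
      using gap_nonneg[OF feas] by (intro sum_nonneg) simp
    then show False using less unfolding objective[OF feas] by simp
  qed

  have "Q = Qbar \<and> (\<forall>t\<in>{1..\<nu>2}. q t = qbar t \<and> P t = Pbar t \<and> \<eta> t = \<eta>bar t)"
    if optimal: "ioc_optimal A B \<nu>2 xr \<phi> \<Sigma>w M N x (Q, q, P, \<eta>, \<xi>)" for Q q P \<eta> \<xi>
  proof -
    let ?\<theta> = "(Q, q, P, \<eta>, \<xi>)"
    have feas: "ioc_feasible A B \<nu>2 xr \<phi> ?\<theta>"
      using optimal by (simp add: ioc_optimal_def is_arg_min_def)
    have "\<not> ioc_objective B \<nu>2 \<Sigma>w M N x ?\<theta>bar < ioc_objective B \<nu>2 \<Sigma>w M N x ?\<theta>"
      using optimal bar_feasible unfolding ioc_optimal_def is_arg_min_def by blast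
    then have le: "(\<Sum>t\<in>{1..<\<nu>2}. 1/2 * (\<integral>\<omega>. stage_gap ?\<theta> x u t \<omega> \<partial>M)) \<le> 0"
      unfolding bar_objective objective[OF feas] by simp
    have gap: "AE \<omega> in M. stage_gap ?\<theta> x u t \<omega> = 0" if t: "t \<in> {1..<\<nu>2}" for t
    proof -
      let ?g = "\<lambda>t. 1/2 * (\<integral>\<omega>. stage_gap ?\<theta> x u t \<omega> \<partial>M)"
      have g: "0 \<le> ?g t" if "t \<in> {1..<\<nu>2}" for t
        using gap_nonneg[OF feas that] by simp
      have "sum ?g {1..<\<nu>2} = 0"
        using le sum_nonneg[of "{1..<\<nu>2}" ?g, OF g] by (rule antisym)
      then have "?g t = 0"
        using sum_nonneg_eq_0_iff[of "{1..<\<nu>2}" ?g] g t by blast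
      then have "(\<integral>\<omega>. stage_gap ?\<theta> x u t \<omega> \<partial>M) = 0" by simp
      then show ?thesis
        using integral_nonneg_eq_0_iff_AE[OF gap_integrable[OF feas t]] gap_nonneg[OF feas t] by blast
    qed
    have lmi: "psd (lmi_matrix A B ?\<theta> t)" if "t \<in> {1..<\<nu>2}" for t
      using feas that by (simp add: ioc_feasible_def)
    \<comment> \<open>\<open>K t\<close> and \<open>k t\<close> come from the true parameter: they
      describe the observed control, which is the same for every candidate.\<close>
    have stationary:
      "(transpose B ** P (t + 1) ** B + mat 1) ** K t = transpose B ** P (t + 1) ** A"
      "P t = transpose A ** P (t + 1) ** A + Q - transpose A ** P (t + 1) ** B ** K t"
      "\<eta> t = q t + transpose A *v \<eta> (t + 1) - transpose A ** P (t + 1) ** B *v k t"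
      if t: "t \<in> {1..<\<nu>2}" for t
      by (rule zero_gap_stationarity[OF lmi[OF t] t gap[OF t] u[OF t] _ assms(12)], erule nondeg[OF t])+
    \<comment> \<open>The true solution is itself a point with zero gaps, so the same lemma writes
      its recursion for \<open>\<eta>bar\<close> with the same offset \<open>k t\<close>.\<close>
    have bar_stationary:
      "\<eta>bar t = qbar t + transpose A *v \<eta>bar (t + 1) - transpose A ** Pbar (t + 1) ** B *v k t"
      if t: "t \<in> {1..<\<nu>2}" for t
      by (rule zero_gap_stationarity(3)[OF bar_lmi(2)[OF t t t] t bar_gap[OF t] u[OF t] _ assms(12)])
         (erule nondeg[OF t])
    have PT: "P \<nu>2 = Q" and \<eta>T: "\<eta> \<nu>2 = q \<nu>2" and q: "\<And>t. t \<in> {1..\<nu>2} \<Longrightarrow> q t = - (Q *v xr t)"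
      and Psym: "\<And>t. t \<in> {1..\<nu>2} \<Longrightarrow> transpose (P t) = P t"
      using feas by (auto simp: ioc_feasible_def intro: psd_symmetric)
    note equal = common_gains_imp_equal_riccati[where P = P and P' = Pbar,
        OF assms(13,15,10) ric Qbar(1) Psym PT stationary(1,2)[unfolded K_def]]
    have Q: "Q = Qbar" by (rule equal(1))
    have P: "P t = Pbar t" if "t \<in> {1..\<nu>2}" for t by (rule equal(2)) (use that in auto)
    have q_eq: "q t = qbar t" if "t \<in> {1..\<nu>2}" for t
      using q qbar Q that by simp
    \<comment> \<open>Once \<open>P\<close> and \<open>q\<close> agree, the two recursions for the
      linear terms coincide, and so do their final values.\<close>
    have "\<eta> t = \<eta>bar t" if t: "1 \<le> t" "t \<le> \<nu>2" for t
      using t(2)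
    proof (induction rule: inc_induct)
      case base
      then show ?case
        using ric \<eta>T q_eq[of \<nu>2] t by (simp add: riccati_iterations_def)
    next
      case (step s)
      then have s: "s \<in> {1..<\<nu>2}" using t by simp
      show ?case
        using stationary(3)[of s] bar_stationary[of s] s step.IH q_eq[of s] P[of "s + 1"] by simp
    qed
    then show ?thesis using Q P q_eq by simp
  qed
  then show ?thesis using bar_optimal by blast
qed

end
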